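(* Let $G$ be an infinite Abelian group and let $\kappa$ be a cardinal. Then $G$ contains a subset $A\subset G$ with packing index $\mathrm{ind}_P(A)=\kappa$ if and only if one of the following conditions holds: (1) $1\le\kappa\le|G|$ and $\kappa\notin\{2,3\}$; (2) $\kappa=2$ and $G$ is not isomorphic to a direct sum $\bigoplus_{i\in I}\mathbb{Z}_3$ (for any index set $I$); (3) $\kappa=3$ and $G$ is isomorphic neither to $\bigoplus_{i\in I}\mathbb{Z}_2$ nor to $\mathbb{Z}_4\oplus\big(\bigoplus_{i\in I}\mathbb{Z}_2\big)$ (for any index set $I$).
   Context: For a subset $A$ of an Abelian group $G$, the packing index $\mathrm{ind}_P(A)$ is the supremum of the cardinals $|B|$ over all subsets $B\subset G$ such that the indexed family $\{b+A:b\in B\}$ is disjoint, i.e. $(b+A)\cap(b'+A)=\emptyset$ for all distinct $b,b'\in B$ (for nonempty $A$ and $B$ this is equivalent to $(B-B)\cap(A-A)=\{0\}$, where $X-X=\{x-y:x,y\in X\}$). $\mathbb{Z}_n$ is the cyclic group of order $n$. *)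

theory Defs
  imports "HOL-Algebra.Algebra" "HOL-Library.Disjoint_Sets"
begin

unbundle cardinal_syntax

text \<open>
  Cardinals are represented by cardinal orders, compared by \<open>\<le>o\<close> and \<open>=o\<close>.
  The supremum is determined only up to \<open>=o\<close>, and it is meaningful for sets of cardinals that are
  bounded by a cardinal on the same type.
\<close>

definition card_Sup :: "'a rel set \<Rightarrow> 'a rel" where
  "card_Sup C = (SOME s. Card_order s \<and> (\<forall>r\<in>C. r \<le>o s) \<and>
     (\<forall>t :: 'a rel. Card_order t \<and> (\<forall>r\<in>C. r \<le>o t) \<longrightarrow> s \<le>o t))"

text \<open>Abelian groups are written multiplicatively in HOL-Algebra: the translate \<open>b + A\<close> is the
  left coset of \<open>A\<close> by \<open>b\<close>.\<close>

definition packing :: "('a, 'm) monoid_scheme \<Rightarrow> 'a set \<Rightarrow> 'a set \<Rightarrow> bool" where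
  "packing G A B \<longleftrightarrow> B \<subseteq> carrier G \<and> disjoint_family_on (\<lambda>b. b <#\<^bsub>G\<^esub> A) B"

definition packing_index :: "('a, 'm) monoid_scheme \<Rightarrow> 'a set \<Rightarrow> 'a rel" where
  "packing_index G A = card_Sup {|B| | B. packing G A B}"

text \<open>The index set may be taken inside the type of the group: see the lemmas on
  \<open>sum_group\<close> below.\<close>

definition iso_direct_sum :: "('a, 'm) monoid_scheme \<Rightarrow> nat \<Rightarrow> bool" where
  "iso_direct_sum G n \<longleftrightarrow> (\<exists>I :: 'a set. G \<cong> sum_group I (\<lambda>_. integer_mod_group n))"

definition iso_Z4_plus_direct_sum_Z2 :: "('a, 'm) monoid_scheme \<Rightarrow> bool" where
  "iso_Z4_plus_direct_sum_Z2 G \<longleftrightarrow>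
     (\<exists>I :: 'a set. G \<cong> integer_mod_group 4 \<times>\<times> sum_group I (\<lambda>_. integer_mod_group 2))"


subsection \<open>The supremum is a genuine one, also for upper bounds on other types\<close>

lemma card_Sup_bounded:
  fixes C :: "'a rel set" and u :: "'a rel"
  assumes "Card_order u" "\<forall>r\<in>C. r \<le>o u"
  shows "Card_order (card_Sup C) \<and> (\<forall>r\<in>C. r \<le>o card_Sup C) \<and>
    (\<forall>t :: 'a rel. Card_order t \<and> (\<forall>r\<in>C. r \<le>o t) \<longrightarrow> card_Sup C \<le>o t)"
proof -
  define R where "R = {t :: 'a rel. Card_order t \<and> (\<forall>r\<in>C. r \<le>o t)}"
  have "u \<in> R" using assms by (simp add: R_def)
  then have "\<exists>s\<in>R. \<forall>t\<in>R. s \<le>o t"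
    by (intro exists_minim_Card_order) (auto simp: R_def)
  then obtain s where s: "s \<in> R" "\<forall>t\<in>R. s \<le>o t" by (rule bexE)
  have "Card_order s \<and> (\<forall>r\<in>C. r \<le>o s) \<and>
     (\<forall>t :: 'a rel. Card_order t \<and> (\<forall>r\<in>C. r \<le>o t) \<longrightarrow> s \<le>o t)"
    using s unfolding R_def by simp
  then show ?thesis unfolding card_Sup_def by (rule someI)
qed

lemma
  fixes t :: "'a rel" and A :: "'a set"
  shows packing_index_Card_order: "Card_order (packing_index G A)"
  and packing_index_upper: "packing G A B \<Longrightarrow> |B| \<le>o packing_index G A"
  and packing_index_least_same: "Card_order t \<Longrightarrow> (\<And>B. packing G A B \<Longrightarrow> |B| \<le>o t)
        \<Longrightarrow> packing_index G A \<le>o t"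
proof -
  let ?C = "{|B| | B. packing G A B}"
  have *: "\<forall>r\<in>?C. r \<le>o |carrier G|"
    by (auto simp: packing_def intro: card_of_mono1)
  have P: "Card_order (packing_index G A) \<and> (\<forall>r\<in>?C. r \<le>o packing_index G A) \<and>
    (\<forall>t :: 'a rel. Card_order t \<and> (\<forall>r\<in>?C. r \<le>o t) \<longrightarrow> packing_index G A \<le>o t)"
    unfolding packing_index_def using card_Sup_bounded[OF card_of_Card_order *] .
  show "Card_order (packing_index G A)" using P by simp
  show "|B| \<le>o packing_index G A" if "packing G A B" using P that by auto
  show "packing_index G A \<le>o t"
    if "Card_order t" "\<And>B. packing G A B \<Longrightarrow> |B| \<le>o t"
  proof -
    have "\<forall>r\<in>?C. r \<le>o t" using that(2) by auto
    with that(1) show ?thesis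
      by (intro P[THEN conjunct2, THEN conjunct2, THEN spec, THEN mp] conjI)
  qed
qed

lemma packing_index_least:
  fixes t :: "'b rel"
  assumes t: "Card_order t" and B: "\<And>B. packing G A B \<Longrightarrow> |B| \<le>o t"
  shows "packing_index G A \<le>o t"
proof (cases "t \<le>o packing_index G A")
  case True
  then have "|Field t| \<le>o |Field (packing_index G A)|" by (rule card_of_mono2)
  then obtain f where f: "inj_on f (Field t)" "f ` Field t \<subseteq> Field (packing_index G A)"
    unfolding card_of_ordLeq[symmetric] by auto
  have "bij_betw f (Field t) (f ` Field t)" using f(1) by (rule inj_on_imp_bij_betw)
  then have "|Field t| =o |f ` Field t|" by (rule card_of_ordIsoI)
  then have tf: "t =o |f ` Field t|"
    using card_of_Field_ordIso[OF t] ordIso_symmetric ordIso_transitive by metis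
  have "packing_index G A \<le>o |f ` Field t|"
    by (rule packing_index_least_same[OF card_of_Card_order])
      (rule ordLeq_ordIso_trans[OF B tf])
  then show ?thesis by (rule ordLeq_ordIso_trans[OF _ ordIso_symmetric[OF tf]])
next
  case False
  have "Well_order t" using t by (rule card_order_on_well_order_on)
  moreover have "Well_order (packing_index G A)"
    using packing_index_Card_order by (rule card_order_on_well_order_on)
  ultimately have "t \<le>o packing_index G A \<or> packing_index G A \<le>o t" by (rule ordLeq_total)
  with False show ?thesis by simp
qed


subsection \<open>Relabelling the index set of a direct sum\<close>

lemma sum_group_relabel:
  assumes f: "inj_on f I" and H: "group H"
  shows "sum_group I (\<lambda>_. H) \<cong> sum_group (f ` I) (\<lambda>_. H)"
proof -
  interpret H: group H by (rule H)
  let ?g = "the_inv_into I f"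
  let ?h = "\<lambda>x. \<lambda>j\<in>f ` I. x (?g j)"
  let ?k = "\<lambda>y. \<lambda>i\<in>I. y (f i)"
  have g: "?g (f i) = i" if "i \<in> I" for i using the_inv_into_f_f[OF f that] .
  have fin1: "finite {j \<in> f ` I. x (?g j) \<noteq> \<one>\<^bsub>H\<^esub>}" if "finite {i \<in> I. x i \<noteq> \<one>\<^bsub>H\<^esub>}" for x
    by (rule finite_subset[OF _ finite_imageI[OF that, of f]]) (auto simp: g)
  have fin2: "finite {i \<in> I. y (f i) \<noteq> \<one>\<^bsub>H\<^esub>}" if fy: "finite {j \<in> f ` I. y j \<noteq> \<one>\<^bsub>H\<^esub>}" for y
  proof (rule finite_imageD[of f])
    show "finite (f ` {i \<in> I. y (f i) \<noteq> \<one>\<^bsub>H\<^esub>})"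
      by (rule finite_subset[OF _ fy]) auto
    show "inj_on f {i \<in> I. y (f i) \<noteq> \<one>\<^bsub>H\<^esub>}" by (rule inj_on_subset[OF f]) auto
  qed
  have c: "carrier (sum_group J (\<lambda>_. H)) = {x \<in> J \<rightarrow>\<^sub>E carrier H. finite {i \<in> J. x i \<noteq> \<one>\<^bsub>H\<^esub>}}" for J
    by (rule carrier_sum_group) (rule H)
  have "bij_betw ?h (carrier (sum_group I (\<lambda>_. H))) (carrier (sum_group (f ` I) (\<lambda>_. H)))"
  proof (rule bij_betw_byWitness[where f' = ?k])
    show "\<forall>x\<in>carrier (sum_group I (\<lambda>_. H)). ?k (?h x) = x"
      by (auto simp: c g fun_eq_iff PiE_def extensional_def)
    show "\<forall>y\<in>carrier (sum_group (f ` I) (\<lambda>_. H)). ?h (?k y) = y"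
      by (auto simp: c g fun_eq_iff PiE_def extensional_def)
    show "?h ` carrier (sum_group I (\<lambda>_. H)) \<subseteq> carrier (sum_group (f ` I) (\<lambda>_. H))"
      by (auto simp: c g PiE_iff cong: conj_cong intro!: fin1)
    show "?k ` carrier (sum_group (f ` I) (\<lambda>_. H)) \<subseteq> carrier (sum_group I (\<lambda>_. H))"
      by (auto simp: c PiE_iff cong: conj_cong intro!: fin2)
  qed
  moreover have "?h \<in> hom (sum_group I (\<lambda>_. H)) (sum_group (f ` I) (\<lambda>_. H))"
  proof (rule homI)
    show "?h x \<in> carrier (sum_group (f ` I) (\<lambda>_. H))" if "x \<in> carrier (sum_group I (\<lambda>_. H))" for x
      using calculation that by (auto simp: bij_betw_def)
  qed (auto simp: g fun_eq_iff)
  ultimately show ?thesis unfolding is_iso_def iso_def by blast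
qed

lemma sum_group_index_embeds:
  assumes "group H" "a \<in> carrier H" "a \<noteq> \<one>\<^bsub>H\<^esub>"
  shows "\<exists>e. inj_on e I \<and> e ` I \<subseteq> carrier (sum_group I (\<lambda>_. H))"
proof (intro exI conjI)
  interpret H: group H by fact
  let ?e = "\<lambda>i. \<lambda>j\<in>I. if j = i then a else \<one>\<^bsub>H\<^esub>"
  show "inj_on ?e I"
    using assms(3) by (auto simp: inj_on_def fun_eq_iff split: if_splits)
  have "finite {j \<in> I. ?e i j \<noteq> \<one>\<^bsub>H\<^esub>}" for i
    by (rule finite_subset[of _ "{i}"]) (auto split: if_splits)
  then show "?e ` I \<subseteq> carrier (sum_group I (\<lambda>_. H))"
    using assms(2) by (auto simp: carrier_sum_group[OF H.is_group] PiE_iff cong: conj_cong)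
qed

lemma iso_direct_sumI:
  fixes G :: "('a, 'm) monoid_scheme" and I :: "'i set"
  assumes iso: "G \<cong> sum_group I (\<lambda>_. integer_mod_group n)" and G: "group G" and n: "n \<noteq> 1"
  shows "iso_direct_sum G n"
proof -
  let ?S = "sum_group I (\<lambda>_. integer_mod_group n)"
  obtain e where e: "inj_on e I" "e ` I \<subseteq> carrier ?S"
    using sum_group_index_embeds[of "integer_mod_group n" 1 I] n by auto
  obtain p where p: "p \<in> iso ?S G" using group.iso_sym[OF G iso] by (auto simp: is_iso_def)
  then have "inj_on (p \<circ> e) I"
    using e by (auto simp: iso_def bij_betw_def intro!: comp_inj_on intro: inj_on_subset)
  then have "?S \<cong> sum_group ((p \<circ> e) ` I) (\<lambda>_. integer_mod_group n)"
    by (rule sum_group_relabel) simp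
  then show ?thesis unfolding iso_direct_sum_def using iso_trans[OF iso] by blast
qed

lemma iso_Z4_plus_direct_sum_Z2I:
  fixes G :: "('a, 'm) monoid_scheme" and I :: "'i set"
  assumes iso: "G \<cong> integer_mod_group 4 \<times>\<times> sum_group I (\<lambda>_. integer_mod_group 2)" and G: "group G"
  shows "iso_Z4_plus_direct_sum_Z2 G"
proof -
  let ?S = "sum_group I (\<lambda>_. integer_mod_group 2)"
  obtain e where e: "inj_on e I" "e ` I \<subseteq> carrier ?S"
    using sum_group_index_embeds[of "integer_mod_group 2" 1 I] by auto
  obtain p where p: "p \<in> iso (integer_mod_group 4 \<times>\<times> ?S) G"
    using group.iso_sym[OF G iso] by (auto simp: is_iso_def)
  have "inj_on (\<lambda>i. (0::int, e i)) I" using e(1) by (auto simp: inj_on_def)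
  moreover have "inj_on p ((\<lambda>i. (0, e i)) ` I)"
    using p e(2) by (auto simp: iso_def bij_betw_def elim!: inj_on_subset)
  ultimately have "inj_on (p \<circ> (\<lambda>i. (0, e i))) I" by (rule comp_inj_on)
  then have "?S \<cong> sum_group ((p \<circ> (\<lambda>i. (0, e i))) ` I) (\<lambda>_. integer_mod_group 2)"
    by (rule sum_group_relabel) simp
  then have "integer_mod_group 4 \<times>\<times> ?S \<cong> integer_mod_group 4 \<times>\<times>
      sum_group ((p \<circ> (\<lambda>i. (0, e i))) ` I) (\<lambda>_. integer_mod_group 2)"
    by (intro group.DirProd_iso_trans iso_refl) (auto simp: iso_refl)
  then show ?thesis unfolding iso_Z4_plus_direct_sum_Z2_def using iso_trans[OF iso] by blast
qed

end

theory Submission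
  imports Defs
begin

text \<open>
  A set \<open>B\<close> is a packing for \<open>A\<close> iff it is a clique of the Cayley graph whose connection set \<open>F\<close> is
  the complement of \<open>A - A\<close>. Every symmetric \<open>F\<close> with \<open>|F| < |G|\<close> arises in this way, up to \<open>0\<close>: a
  transfinite recursion puts pairs \<open>x, g + x\<close> with \<open>g \<notin> F\<close> into \<open>A\<close>, and each step has to avoid
  fewer than \<open>|G|\<close> values of \<open>x\<close>. It remains to find an \<open>F\<close> with clique number \<open>\<kappa>\<close>.

  For infinite \<open>\<kappa>\<close>, \<open>F = B - B\<close> with \<open>|B| = \<kappa>\<close> works. For finite \<open>\<kappa> \<ge> 3\<close> one takes \<open>F = S - S\<close> where
  \<open>S\<close> has \<open>\<kappa>\<close> elements and satisfies no unforced relation with coefficients bounded by \<open>3\<close>. A clique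
  through \<open>0\<close> is then a family of pairs from \<open>S\<close>, any two of which agree in a coordinate, so that they
  all agree in the same one. In \<open>2\<close>-torsion the pairs are unordered and the triangle
  \<open>{x, y}, {y, z}, {x, z}\<close> is a further possibility, which exceeds the bound only for \<open>\<kappa> = 3\<close>.

  Conversely, \<open>{0, g}\<close> extends to the packing \<open>{0, g, -g}\<close> if \<open>3g = 0\<close>. If \<open>|2G| \<le> 2\<close>, any three-element
  packing can be translated to \<open>{0, s, z}\<close> with \<open>2s = 0\<close>, and then \<open>s + z\<close> can be added.
\<close>

subsection \<open>Packings as cliques of a Cayley graph\<close>

text \<open>\<open>B\<close> is a clique in the Cayley graph of \<open>G\<close> with connection set \<open>F - {\<one>}\<close>.\<close>
definition diff_clique :: "('a, 'm) monoid_scheme \<Rightarrow> 'a set \<Rightarrow> 'a set \<Rightarrow> bool" where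
  "diff_clique G F B \<longleftrightarrow> B \<subseteq> carrier G \<and>
     (\<forall>b\<in>B. \<forall>b'\<in>B. b \<noteq> b' \<longrightarrow> b \<otimes>\<^bsub>G\<^esub> inv\<^bsub>G\<^esub> b' \<in> F)"

lemma (in group) div_eq_one_iff:
  "x \<in> carrier G \<Longrightarrow> y \<in> carrier G \<Longrightarrow> x \<otimes> inv y = \<one> \<longleftrightarrow> x = y"
  by (metis inv_closed inv_equality inv_inv r_inv)

lemma (in comm_group) div_eq_div_iff:
  assumes "a \<in> carrier G" "b \<in> carrier G" "c \<in> carrier G" "d \<in> carrier G"
  shows "a \<otimes> inv b = c \<otimes> inv d \<longleftrightarrow> a \<otimes> d = c \<otimes> b"
proof
  assume "a \<otimes> inv b = c \<otimes> inv d"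
  then have "a \<otimes> inv b \<otimes> (b \<otimes> d) = c \<otimes> inv d \<otimes> (b \<otimes> d)" by simp
  with assms show "a \<otimes> d = c \<otimes> b"
    by (smt (verit) inv_closed m_assoc m_closed m_comm r_inv r_one)
next
  assume "a \<otimes> d = c \<otimes> b"
  then have "a \<otimes> d \<otimes> (inv b \<otimes> inv d) = c \<otimes> b \<otimes> (inv b \<otimes> inv d)" by simp
  with assms show "a \<otimes> inv b = c \<otimes> inv d"
    by (smt (verit) inv_closed m_assoc m_closed m_comm r_inv r_one)
qed

text \<open>A common point \<open>b + a' = b' + a\<close> of two translates rearranges to
  \<open>b - b' = a - a'\<close>.\<close>

lemma (in comm_group) packing_iff:
  assumes A: "A \<subseteq> carrier G"
  shows "packing G A B \<longleftrightarrow> B \<subseteq> carrier G \<and>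
    (\<forall>b\<in>B. \<forall>b'\<in>B. b \<noteq> b' \<longrightarrow> \<not> (\<exists>a\<in>A. \<exists>a'\<in>A. b \<otimes> inv b' = a \<otimes> inv a'))"
proof -
  have "(b <# A) \<inter> (b' <# A) = {} \<longleftrightarrow> \<not> (\<exists>a\<in>A. \<exists>a'\<in>A. b \<otimes> inv b' = a \<otimes> inv a')"
    if "b \<in> carrier G" "b' \<in> carrier G" for b b'
  proof -
    have "(b <# A) \<inter> (b' <# A) = {} \<longleftrightarrow> \<not> (\<exists>a\<in>A. \<exists>a'\<in>A. b \<otimes> a' = b' \<otimes> a)"
      by (auto simp: l_coset_def)
    moreover have "b \<otimes> a' = b' \<otimes> a \<longleftrightarrow> b \<otimes> inv b' = a \<otimes> inv a'" if "a \<in> A" "a' \<in> A" for a a'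
      using div_eq_div_iff[of b b' a a'] that A \<open>b \<in> carrier G\<close> \<open>b' \<in> carrier G\<close>
      by (auto simp: m_comm subset_iff)
    ultimately show ?thesis by blast
  qed
  then show ?thesis
    unfolding packing_def disjoint_family_on_def
    by (intro conj_cong ball_cong imp_cong refl) blast
qed

text \<open>Initial segments of the well-order \<open>|carrier G|\<close> are smaller than
  \<open>G\<close>. At stage \<open>g\<close> the recursion picks \<open>f g\<close> so that the
  pair \<open>f g\<close>, \<open>g + f g\<close> has no difference in \<open>F\<close> with any
  earlier pair; the pair itself realizes \<open>g\<close> as a difference.\<close>

lemma (in comm_group) exists_set_with_differences:
  assumes inf: "infinite (carrier G)" and F: "F \<subseteq> carrier G"
    and sym: "\<And>x. x \<in> F \<Longrightarrow> inv x \<in> F" and small: "|F| <o |carrier G|"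
  shows "\<exists>A\<subseteq>carrier G. \<forall>x\<in>carrier G. x \<noteq> \<one> \<longrightarrow>
    (\<exists>a\<in>A. \<exists>a'\<in>A. x = a \<otimes> inv a') \<longleftrightarrow> x \<notin> F"
proof -
  let ?r = "|carrier G|"
  define R where "R = ?r - Id"
  have wo: "Well_order ?r" by simp
  have Fr: "Field ?r = carrier G" by simp
  have "wf R" using wo by (simp add: R_def well_order_on_def)
  have R: "(h, g) \<in> R \<longleftrightarrow> h \<in> underS ?r g" for h g
    by (auto simp: R_def underS_def)
  have Rc: "h \<in> carrier G" "g \<in> carrier G" if "(h, g) \<in> R" for h g
    using that Fr by (auto simp: R_def Field_def)
  have lin: "(h, g) \<in> R \<or> (g, h) \<in> R" if "h \<in> carrier G" "g \<in> carrier G" "g \<noteq> h" for g h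
    using wo that unfolding well_order_on_def linear_order_on_def total_on_def Fr
    by (auto simp: R_def)
  \<comment> \<open>Admissibility of \<open>x\<close> at stage \<open>g\<close>. The two membership
    premises keep \<open>P\<close> satisfiable outside the carrier and spare the recursion a proof
    that earlier values lie in \<open>G\<close>.\<close>
  define P where "P f g x \<longleftrightarrow> (g \<in> carrier G \<longrightarrow> x \<in> carrier G \<and>
     (\<forall>h. (h, g) \<in> R \<longrightarrow> f h \<in> carrier G \<longrightarrow>
        (\<forall>u\<in>{x, g \<otimes> x}. \<forall>v\<in>{f h, h \<otimes> f h}. u \<otimes> inv v \<notin> F)))" for f g x
  have "\<exists>f. \<forall>g. P f g (f g)"
  proof (rule dependent_wf_choice[OF \<open>wf R\<close>])
    show "P f x r = P g x r" if "\<And>z. (z, x) \<in> R \<Longrightarrow> f z = g z" for f g x r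
      using that by (simp add: P_def cong: imp_cong)
    show "\<exists>x. P f g x" for g f
    proof (cases "g \<in> carrier G")
      case True
      let ?I = "underS ?r g"
      \<comment> \<open>Solving \<open>u - v = w\<close> for \<open>x\<close> lists the forbidden
        values: \<open>s\<close> tells whether \<open>v\<close> is \<open>f h\<close> or
        \<open>h + f h\<close>, and \<open>t\<close> whether \<open>u\<close> is \<open>x\<close> or
        \<open>g + x\<close>.\<close>
      let ?b = "\<lambda>(h, w, s, t). w \<otimes> (if s then f h else h \<otimes> f h) \<otimes> (if t then \<one> else inv g)"
      let ?D = "?I \<times> F \<times> (UNIV :: bool set) \<times> (UNIV :: bool set)"
      have "|?I| <o ?r" using card_of_underS[of ?r g] True Fr by simp
      moreover have "|UNIV :: bool set| <o ?r" using inf by (simp add: finite_ordLess_infinite2)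
      ultimately have "|?D| <o ?r"
        using inf small by (intro card_of_Times_ordLess_infinite)
      then have "|?b ` ?D| <o ?r" by (rule ordLeq_ordLess_trans[OF card_of_image])
      then have "\<not> carrier G \<subseteq> ?b ` ?D"
        using card_of_mono1 not_ordLess_ordLeq by blast
      then obtain x where x: "x \<in> carrier G" "x \<notin> ?b ` ?D" by blast
      have "P f g x" unfolding P_def
      proof (intro impI conjI allI ballI x(1) notI)
        fix h u v assume h: "(h, g) \<in> R" "f h \<in> carrier G" and u: "u \<in> {x, g \<otimes> x}"
          and v: "v \<in> {f h, h \<otimes> f h}" and w: "u \<otimes> inv v \<in> F"
        have hc: "h \<in> carrier G" using Rc[OF h(1)] by simp
        have vc: "v \<in> carrier G" using v hc h by auto
        have uc: "u \<in> carrier G" using u x True by auto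
        have "x = u \<otimes> (if u = x then \<one> else inv g)"
        proof (cases "u = x")
          case False
          then have "u = x \<otimes> g" using u x(1) True by (simp add: m_comm)
          then show ?thesis using False x(1) True by (simp add: m_assoc)
        qed (use x(1) in simp)
        also have "\<dots> = u \<otimes> inv v \<otimes> v \<otimes> (if u = x then \<one> else inv g)"
          using uc vc by (simp add: m_assoc)
        also have "\<dots> = ?b (h, u \<otimes> inv v, v = f h, u = x)"
          using v by (cases "v = f h") simp_all
        finally have "x = ?b (h, u \<otimes> inv v, v = f h, u = x)" .
        moreover have "(h, u \<otimes> inv v, v = f h, u = x) \<in> ?D" using w h(1) R by simp
        ultimately show False using x(2) by blast
      qed
      then show ?thesis ..
    qed (simp add: P_def)
  qed
  then obtain f where f: "\<And>g. P f g (f g)" by blast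
  have fc: "f g \<in> carrier G" if "g \<in> carrier G" for g using f[of g] that by (simp add: P_def)
  define A where "A = (\<Union>g\<in>carrier G - F. {f g, g \<otimes> f g})"
  have Ac: "A \<subseteq> carrier G" using fc by (auto simp: A_def)
  have less: "u \<otimes> inv v \<notin> F" if "(h, g) \<in> R" "u \<in> {f g, g \<otimes> f g}" "v \<in> {f h, h \<otimes> f h}" for g h u v
    using f[of g] that fc Rc[OF that(1)] unfolding P_def by blast
  have inv_div: "inv (u \<otimes> inv v) = v \<otimes> inv u" if "u \<in> carrier G" "v \<in> carrier G" for u v
    using that by (simp add: inv_mult_group)
  have notF: "u \<otimes> inv v \<notin> F" if uv: "u \<in> A" "v \<in> A" "u \<otimes> inv v \<noteq> \<one>" for u v
  proof
    assume a: "u \<otimes> inv v \<in> F"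
    have uvc: "u \<in> carrier G" "v \<in> carrier G" using uv Ac by auto
    \<comment> \<open>\<open>less\<close> controls only later minus earlier, so symmetry of
      \<open>F\<close> is used to have both signs available. Within a single pair the two nonzero
      differences are \<open>g\<close> and \<open>-g\<close>, and \<open>g\<close> is not in
      \<open>F\<close>.\<close>
    have a': "v \<otimes> inv u \<in> F" using sym[OF a] inv_div[OF uvc] by simp
    obtain g h where g: "g \<in> carrier G - F" "u \<in> {f g, g \<otimes> f g}"
      and h: "h \<in> carrier G - F" "v \<in> {f h, h \<otimes> f h}"
      using uv(1,2) unfolding A_def by blast
    have "g = h"
      using lin[of g h] less[of g h v u] less[of h g u v] g h a a' by blast
    moreover have "g \<otimes> f g \<otimes> inv (f g) = g" using g fc by (simp add: m_assoc)
    moreover have "u \<noteq> v" using uv(3) uvc by auto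
    ultimately show False using g h a a' by auto
  qed
  have "\<exists>a\<in>A. \<exists>a'\<in>A. x = a \<otimes> inv a'" if x: "x \<in> carrier G" "x \<notin> F" for x
  proof -
    have "x \<otimes> f x \<in> A" "f x \<in> A" using x by (auto simp: A_def)
    moreover have "x = x \<otimes> f x \<otimes> inv (f x)" using x fc by (simp add: m_assoc)
    ultimately show ?thesis by blast
  qed
  then have "\<forall>x\<in>carrier G. x \<noteq> \<one> \<longrightarrow> (\<exists>a\<in>A. \<exists>a'\<in>A. x = a \<otimes> inv a') \<longleftrightarrow> x \<notin> F"
    using notF by metis
  with Ac show ?thesis by (intro exI[of _ A] conjI)
qed

text \<open>For the set \<open>A\<close> obtained from \<open>F\<close>, the packings are exactly
  the cliques, so the index is the largest clique size.\<close>

lemma (in comm_group) realize_by_clique: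
  assumes inf: "infinite (carrier G)" and F: "F \<subseteq> carrier G"
    and sym: "\<And>x. x \<in> F \<Longrightarrow> inv x \<in> F" and small: "|F| <o |carrier G|"
    and B: "diff_clique G F B" "|B| =o \<kappa>" and \<kappa>: "Card_order \<kappa>"
    and max: "\<And>C. diff_clique G F C \<Longrightarrow> |C| \<le>o \<kappa>"
  shows "\<exists>A\<subseteq>carrier G. packing_index G A =o \<kappa>"
proof -
  obtain A where A: "A \<subseteq> carrier G"
    "\<And>x. x \<in> carrier G \<Longrightarrow> x \<noteq> \<one> \<Longrightarrow> (\<exists>a\<in>A. \<exists>a'\<in>A. x = a \<otimes> inv a') \<longleftrightarrow> x \<notin> F"
    using exists_set_with_differences[OF inf F sym small] by blast
  have iff: "packing G A C \<longleftrightarrow> diff_clique G F C" for C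
    unfolding packing_iff[OF A(1)] diff_clique_def
  proof (intro conj_cong ball_cong imp_cong refl)
    fix b b' assume "C \<subseteq> carrier G" "b \<in> C" "b' \<in> C" "b \<noteq> b'"
    then have "b \<otimes> inv b' \<in> carrier G" "b \<otimes> inv b' \<noteq> \<one>"
      by (auto simp: div_eq_one_iff subset_iff)
    then show "(\<not> (\<exists>a\<in>A. \<exists>a'\<in>A. b \<otimes> inv b' = a \<otimes> inv a')) \<longleftrightarrow> b \<otimes> inv b' \<in> F"
      using A(2) by blast
  qed
  have "packing_index G A \<le>o \<kappa>"
    using max iff by (intro packing_index_least[OF \<kappa>]) auto
  moreover have "\<kappa> \<le>o packing_index G A"
    using packing_index_upper[of G A B] B iff ordIso_ordLeq_trans ordIso_symmetric by blast
  ultimately show ?thesis using A(1) by (auto simp: ordIso_iff_ordLeq)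
qed

text \<open>With \<open>F = B - B\<close>, the set \<open>B\<close> is a clique of size
  \<open>\<kappa>\<close>. Translating any clique by one of its members embeds it into
  \<open>F\<close>, and \<open>F\<close> is an image of \<open>B \<times> B\<close>, hence of size
  at most \<open>\<kappa>\<close>.\<close>

lemma (in comm_group) exists_index_infinite:
  assumes inf: "infinite (carrier G)" and \<kappa>: "Card_order \<kappa>" "infinite (Field \<kappa>)" "\<kappa> <o |carrier G|"
  shows "\<exists>A\<subseteq>carrier G. packing_index G A =o \<kappa>"
proof -
  have "|Field \<kappa>| \<le>o |carrier G|"
    using \<kappa> card_of_Field_ordIso ordIso_ordLeq_trans ordLess_imp_ordLeq by blast
  then obtain e where e: "inj_on e (Field \<kappa>)" "e ` Field \<kappa> \<subseteq> carrier G"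
    unfolding card_of_ordLeq[symmetric] by blast
  define B where "B = e ` Field \<kappa>"
  have "|Field \<kappa>| =o |B|" unfolding B_def by (rule card_of_ordIsoI[OF inj_on_imp_bij_betw[OF e(1)]])
  then have B\<kappa>: "|B| =o \<kappa>"
    using card_of_Field_ordIso[OF \<kappa>(1)] ordIso_symmetric ordIso_transitive by blast
  have Bc: "B \<subseteq> carrier G" using e by (simp add: B_def)
  have Binf: "infinite B" using \<kappa>(2) e(1) by (simp add: B_def finite_image_iff)
  define F where "F = (\<lambda>(x, y). x \<otimes> inv y) ` (B \<times> B)"
  have "|B \<times> B| =o |B|" using Binf by (simp add: card_of_Times_same_infinite)
  then have F\<kappa>: "|F| \<le>o \<kappa>"
    unfolding F_def by (rule ordLeq_ordIso_trans[OF ordLeq_ordIso_trans[OF card_of_image] B\<kappa>])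
  show ?thesis
  proof (rule realize_by_clique[OF inf _ _ _ _ B\<kappa> \<kappa>(1)])
    show "F \<subseteq> carrier G" using Bc by (auto simp: F_def)
    show "inv x \<in> F" if x: "x \<in> F" for x
    proof -
      obtain a b where ab: "a \<in> B" "b \<in> B" "x = a \<otimes> inv b" using x by (auto simp: F_def)
      then have "inv x = b \<otimes> inv a" using Bc by (simp add: inv_mult_group subset_iff)
      then show ?thesis using ab by (auto simp: F_def)
    qed
    show "|F| <o |carrier G|" using F\<kappa> \<kappa>(3) ordLeq_ordLess_trans by blast
    show "diff_clique G F B" using Bc by (auto simp: diff_clique_def F_def)
    show "|C| \<le>o \<kappa>" if C: "diff_clique G F C" for C
    proof (cases "C = {}")
      case True
      then show ?thesis using card_of_empty1 \<kappa>(1) by (metis card_order_on_well_order_on)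
    next
      case False
      then obtain c where c: "c \<in> C" by blast
      have Cc: "C \<subseteq> carrier G" using C by (simp add: diff_clique_def)
      obtain b where b: "b \<in> B" using Binf by fastforce
      then have oneF: "\<one> \<in> F" using Bc by (auto simp: F_def image_iff subset_iff intro!: bexI[of _ b])
      have "inj_on (\<lambda>x. x \<otimes> inv c) C" using Cc c by (auto simp: inj_on_def subset_iff)
      moreover have "(\<lambda>x. x \<otimes> inv c) ` C \<subseteq> F"
      proof (intro image_subsetI)
        fix x assume "x \<in> C"
        then show "x \<otimes> inv c \<in> F"
          using C c oneF Cc by (cases "x = c") (auto simp: diff_clique_def subset_iff)
      qed
      ultimately have "|C| \<le>o |F|" unfolding card_of_ordLeq[symmetric] by blast
      then show ?thesis using F\<kappa> ordLeq_transitive by blast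
    qed
  qed
qed

subsection \<open>Cliques in the differences of a finite set\<close>

text \<open>Two pairs \<open>(a, b)\<close>, \<open>(a, c)\<close> force every other pair to start
  with \<open>a\<close>, and dually for second coordinates; such a star has at most
  \<open>card S - 1\<close> members. If no two pairs agree in a coordinate, only one pair and its
  reverse remain, and \<open>2 \<le> card S - 1\<close>.\<close>

lemma card_le_of_pairwise_sharing:
  assumes S: "finite S" "card S \<ge> 3" and P: "P \<subseteq> S \<times> S" and off: "\<And>i j. (i, j) \<in> P \<Longrightarrow> i \<noteq> j"
    and sh: "\<And>i j k l. (i, j) \<in> P \<Longrightarrow> (k, l) \<in> P \<Longrightarrow> (i, j) \<noteq> (k, l) \<Longrightarrow>
      i = k \<or> j = l \<or> (i = l \<and> j = k)"
  shows "card P \<le> card S - 1"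
proof (cases "\<exists>a b c. (a, b) \<in> P \<and> (a, c) \<in> P \<and> b \<noteq> c")
  case True
  then obtain a b c where abc: "(a, b) \<in> P" "(a, c) \<in> P" "b \<noteq> c" by blast
  have "k = a" if "(k, l) \<in> P" for k l
    using sh[OF abc(1) that] sh[OF abc(2) that] off abc that by blast
  then have "P \<subseteq> {a} \<times> (S - {a})" using P off by blast
  then have "card P \<le> card ({a} \<times> (S - {a}))" using S by (intro card_mono) auto
  moreover have "a \<in> S" using abc P by blast
  ultimately show ?thesis using S by (simp add: card_cartesian_product)
next
  case one: False
  show ?thesis
  proof (cases "\<exists>a b c. (b, a) \<in> P \<and> (c, a) \<in> P \<and> b \<noteq> c")
    case True
    then obtain a b c where abc: "(b, a) \<in> P" "(c, a) \<in> P" "b \<noteq> c" by blast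
    have "l = a" if "(k, l) \<in> P" for k l
      using sh[OF abc(1) that] sh[OF abc(2) that] off abc that by blast
    then have "P \<subseteq> (S - {a}) \<times> {a}" using P off by blast
    then have "card P \<le> card ((S - {a}) \<times> {a})" using S by (intro card_mono) auto
    moreover have "a \<in> S" using abc P by blast
    ultimately show ?thesis using S by (simp add: card_cartesian_product)
  next
    case two: False
    have o1: "b = c" if "(a, b) \<in> P" "(a, c) \<in> P" for a b c using one that by blast
    have o2: "b = c" if "(b, a) \<in> P" "(c, a) \<in> P" for a b c using two that by blast
    obtain a b where ab: "P \<subseteq> {(a, b), (b, a)}"
    proof (cases "P = {}")
      case False
      then obtain a b where ab: "(a, b) \<in> P" by auto
      have "(k, l) \<in> {(a, b), (b, a)}" if kl: "(k, l) \<in> P" for k l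
      proof (cases "(a, b) = (k, l)")
        case False
        from sh[OF ab kl False] show ?thesis
        proof (elim disjE)
          assume "a = k"
          then show ?thesis using o1[of a b l] ab kl by simp
        next
          assume "b = l"
          then show ?thesis using o2[of a b k] ab kl by simp
        qed simp
      qed simp
      then have "P \<subseteq> {(a, b), (b, a)}" by (rule subrelI)
      then show ?thesis by (rule that)
    qed (rule that[of undefined undefined], simp)
    have "card P \<le> card {(a, b), (b, a)}" by (rule card_mono[OF _ ab]) simp
    also have "card {(a, b), (b, a)} \<le> 2" by (rule card_insert_le_m1) simp_all
    finally show ?thesis using S(2) by simp
  qed
qed

text \<open>A family of pairwise intersecting edges is a star or lies in a triangle. A star has at
  most \<open>card S - 1\<close> edges, and a triangle has
  \<open>3 \<le> card S - 1\<close>.\<close>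

lemma card_le_of_intersecting_edges:
  assumes S: "finite S" "card S \<ge> 4" and P: "P \<subseteq> S \<times> S" and off: "\<And>i j. (i, j) \<in> P \<Longrightarrow> i \<noteq> j"
    and asym: "\<And>i j. (i, j) \<in> P \<Longrightarrow> (j, i) \<notin> P"
    and sh: "\<And>i j k l. (i, j) \<in> P \<Longrightarrow> (k, l) \<in> P \<Longrightarrow> {i, j} \<inter> {k, l} \<noteq> {}"
  shows "card P \<le> card S - 1"
proof -
  define E where "E = (\<lambda>(i, j). {i, j}) ` P"
  \<comment> \<open>By \<open>asym\<close> no edge is counted in both orientations.\<close>
  have "inj_on (\<lambda>(i, j). {i, j}) P"
    using asym by (auto simp: inj_on_def doubleton_eq_iff)
  then have card_E: "card P = card E" by (simp add: E_def card_image)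
  have E: "\<exists>i j. e = {i, j} \<and> i \<noteq> j \<and> i \<in> S \<and> j \<in> S" if "e \<in> E" for e
    using that off P by (fastforce simp: E_def)
  have int: "e \<inter> f \<noteq> {}" if "e \<in> E" "f \<in> E" for e f
  proof -
    obtain i j where "(i, j) \<in> P" "e = {i, j}" using \<open>e \<in> E\<close> by (auto simp: E_def)
    moreover obtain k l where "(k, l) \<in> P" "f = {k, l}" using \<open>f \<in> E\<close> by (auto simp: E_def)
    ultimately show ?thesis using sh[of i j k l] by simp
  qed
  have finE: "finite E" using finite_subset[OF P] S by (simp add: E_def)
  show ?thesis
  proof (cases "card E \<le> 1")
    case True
    then show ?thesis using card_E S by linarith
  next
    case False
    then obtain e f where ef: "e \<in> E" "f \<in> E" "e \<noteq> f"
      using finE by (metis One_nat_def card_le_Suc0_iff_eq)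
    obtain a b c where abc: "e = {a, b}" "f = {a, c}" "a \<noteq> b" "a \<noteq> c" "b \<noteq> c" "a \<in> S"
      using E[OF ef(1)] E[OF ef(2)] int[OF ef(1,2)] ef(3) by (auto simp: insert_commute)
    show ?thesis
    proof (cases "\<forall>g\<in>E. a \<in> g")
      case True
      have "E \<subseteq> (\<lambda>x. {a, x}) ` (S - {a})"
      proof
        fix g assume "g \<in> E"
        then show "g \<in> (\<lambda>x. {a, x}) ` (S - {a})"
          using E[of g] True by (auto simp: image_iff insert_commute)
      qed
      then have "card E \<le> card (S - {a})"
        using S surj_card_le[of "S - {a}" E "\<lambda>x. {a, x}"] by simp
      then show ?thesis using card_E S abc by simp
    next
      case False
      then obtain g where g: "g \<in> E" "a \<notin> g" by blast
      then have g': "g = {b, c}" using E[OF g(1)] int[OF g(1) ef(1)] int[OF g(1) ef(2)] abc by auto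
      have "E \<subseteq> {{a, b}, {a, c}, {b, c}}"
      proof
        fix h assume h: "h \<in> E"
        then show "h \<in> {{a, b}, {a, c}, {b, c}}"
          using E[OF h] int[OF h ef(1)] int[OF h ef(2)] int[OF h g(1)] g' abc
          by (auto simp: insert_commute)
      qed
      then have "card E \<le> card {{a, b}, {a, c}, {b, c}}" by (intro card_mono) auto
      also have "\<dots> \<le> 3" by (intro card_insert_le_m1) simp_all
      finally show ?thesis using card_E S(2) by simp
    qed
  qed
qed

definition diffs :: "('a, 'm) monoid_scheme \<Rightarrow> 'a set \<Rightarrow> 'a set" where
  "diffs G S = (\<lambda>(x, y). x \<otimes>\<^bsub>G\<^esub> inv\<^bsub>G\<^esub> y) ` (S \<times> S)"

text \<open>After a translation by some \<open>b0\<close> in \<open>B\<close>, each other clique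
  member is a nonzero difference of elements of \<open>S\<close>, hence comes from a pair in
  \<open>P\<close>; the \<open>Suc\<close> accounts for \<open>b0\<close>. Differences of clique
  members lie in \<open>S - S\<close> again, which gives the relation between two pairs.\<close>

lemma (in comm_group) diff_clique_diffs_pairs:
  assumes S: "finite S" "S \<subseteq> carrier G" and B: "diff_clique G (diffs G S) B"
  obtains P where "P \<subseteq> S \<times> S" "finite B" "card B \<le> Suc (card P)"
    "\<And>i j. (i, j) \<in> P \<Longrightarrow> i \<noteq> j"
    "\<And>i j k l. (i, j) \<in> P \<Longrightarrow> (k, l) \<in> P \<Longrightarrow> (i, j) \<noteq> (k, l) \<Longrightarrow>
       i \<otimes> inv j \<noteq> k \<otimes> inv l \<and>
       (\<exists>m\<in>S. \<exists>n\<in>S. m \<noteq> n \<and> i \<otimes> inv j \<otimes> inv (k \<otimes> inv l) = m \<otimes> inv n)"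
proof (cases "B = {}")
  case True
  then show ?thesis using that[of "{}"] by simp
next
  case False
  then obtain b0 where b0: "b0 \<in> B" by blast
  have Bc: "B \<subseteq> carrier G" using B by (simp add: diff_clique_def)
  then have b0c: "b0 \<in> carrier G" using b0 by blast
  have D: "\<exists>m\<in>S. \<exists>n\<in>S. m \<noteq> n \<and> b \<otimes> inv b' = m \<otimes> inv n"
    if "b \<in> B" "b' \<in> B" "b \<noteq> b'" for b b'
  proof -
    have "b \<otimes> inv b' \<in> diffs G S" using B that by (simp add: diff_clique_def)
    then obtain m n where mn: "m \<in> S" "n \<in> S" "b \<otimes> inv b' = m \<otimes> inv n"
      by (auto simp: diffs_def)
    moreover have "b \<otimes> inv b' \<noteq> \<one>" using that Bc by (auto simp: div_eq_one_iff subset_iff)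
    ultimately have "m \<noteq> n" using S(2) by auto
    with mn show ?thesis by blast
  qed
  \<comment> \<open>A difference may come from several pairs; \<open>p\<close> selects one for each
    \<open>b\<close>.\<close>
  have "\<forall>b\<in>B - {b0}. \<exists>p. p \<in> S \<times> S \<and> fst p \<noteq> snd p \<and> b \<otimes> inv b0 = fst p \<otimes> inv (snd p)"
  proof
    fix b assume "b \<in> B - {b0}"
    then obtain m n where "m \<in> S" "n \<in> S" "m \<noteq> n" "b \<otimes> inv b0 = m \<otimes> inv n"
      using D[of b b0] b0 by blast
    then show "\<exists>p. p \<in> S \<times> S \<and> fst p \<noteq> snd p \<and> b \<otimes> inv b0 = fst p \<otimes> inv (snd p)"
      by (intro exI[of _ "(m, n)"]) simp
  qed
  then obtain p where p: "\<And>b. b \<in> B - {b0} \<Longrightarrow> p b \<in> S \<times> S \<and> fst (p b) \<noteq> snd (p b) \<and>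
      b \<otimes> inv b0 = fst (p b) \<otimes> inv (snd (p b))"
    by metis
  have inj: "inj_on p (B - {b0})"
  proof (rule inj_onI)
    fix x y assume xy: "x \<in> B - {b0}" "y \<in> B - {b0}" "p x = p y"
    then have "x \<otimes> inv b0 = y \<otimes> inv b0" using p by metis
    then show "x = y" using xy Bc b0c by (simp add: subset_iff)
  qed
  have sub: "p ` (B - {b0}) \<subseteq> S \<times> S" using p by blast
  then have fin: "finite (B - {b0})"
    by (intro finite_imageD[OF finite_subset[OF sub] inj]) (simp add: S)
  show ?thesis
  proof (rule that[OF sub])
    show "finite B" using fin by simp
    show "card B \<le> Suc (card (p ` (B - {b0})))"
      using card_image[OF inj] fin b0 by (simp add: card_Diff_singleton)
    show "i \<noteq> j" if ij: "(i, j) \<in> p ` (B - {b0})" for i j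
    proof -
      obtain b where "b \<in> B - {b0}" "p b = (i, j)" using ij by force
      then show ?thesis using p[of b] by simp
    qed
    show "i \<otimes> inv j \<noteq> k \<otimes> inv l \<and>
       (\<exists>m\<in>S. \<exists>n\<in>S. m \<noteq> n \<and> i \<otimes> inv j \<otimes> inv (k \<otimes> inv l) = m \<otimes> inv n)"
      if ij: "(i, j) \<in> p ` (B - {b0})" and kl: "(k, l) \<in> p ` (B - {b0})" and ne: "(i, j) \<noteq> (k, l)" for i j k l
    proof -
      obtain x where x: "x \<in> B - {b0}" "p x = (i, j)" using ij by force
      obtain y where y: "y \<in> B - {b0}" "p y = (k, l)" using kl by force
      have xy: "x \<noteq> y" using x y ne by auto
      have xyc: "x \<in> carrier G" "y \<in> carrier G" using x y Bc by auto
      have ex: "x \<otimes> inv b0 = i \<otimes> inv j" "y \<otimes> inv b0 = k \<otimes> inv l" using p[OF x(1)] p[OF y(1)] x y by auto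
      have "x \<otimes> inv b0 \<otimes> inv (y \<otimes> inv b0) = x \<otimes> inv y"
        using xyc b0c by (simp add: inv_mult_group m_assoc) (metis inv_closed inv_solve_left m_closed)
      then show ?thesis using D[of x y] x(1) y(1) xy xyc b0c ex[symmetric] by simp
    qed
  qed
qed

section \<open>Integer linear combinations\<close>

definition lincomb :: "('a, 'm) monoid_scheme \<Rightarrow> ('a \<Rightarrow> int) \<Rightarrow> 'a set \<Rightarrow> 'a" where
  "lincomb G c S = finprod G (\<lambda>x. x [^]\<^bsub>G\<^esub> c x) S"

lemma (in comm_group) lincomb_closed [simp]: "S \<subseteq> carrier G \<Longrightarrow> lincomb G c S \<in> carrier G"
  unfolding lincomb_def by (rule finprod_closed) auto

lemma (in comm_group) lincomb_empty [simp]: "lincomb G c {} = \<one>"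
  by (simp add: lincomb_def)

lemma (in comm_group) lincomb_insert:
  "finite S \<Longrightarrow> x \<notin> S \<Longrightarrow> S \<subseteq> carrier G \<Longrightarrow> x \<in> carrier G \<Longrightarrow>
    lincomb G c (insert x S) = x [^] c x \<otimes> lincomb G c S"
  unfolding lincomb_def by (rule finprod_insert) auto

lemma (in comm_group) lincomb_cong:
  "S \<subseteq> carrier G \<Longrightarrow> (\<And>x. x \<in> S \<Longrightarrow> c x = d x) \<Longrightarrow> lincomb G c S = lincomb G d S"
  unfolding lincomb_def by (rule finprod_cong') auto

lemma (in comm_group) lincomb_add:
  assumes "S \<subseteq> carrier G"
  shows "lincomb G (\<lambda>x. c x + d x) S = lincomb G c S \<otimes> lincomb G d S"
proof -
  have "finprod G (\<lambda>x. x [^] (c x + d x)) S = finprod G (\<lambda>x. x [^] c x \<otimes> x [^] d x) S"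
    using assms by (intro finprod_cong') (auto simp: int_pow_mult)
  also have "\<dots> = finprod G (\<lambda>x. x [^] c x) S \<otimes> finprod G (\<lambda>x. x [^] d x) S"
    using assms by (intro finprod_multf) auto
  finally show ?thesis by (simp add: lincomb_def)
qed

lemma (in comm_group) lincomb_zero [simp]: "lincomb G (\<lambda>_. 0) S = \<one>"
  by (simp add: lincomb_def)

lemma (in comm_group) lincomb_mult:
  "finite S \<Longrightarrow> S \<subseteq> carrier G \<Longrightarrow> lincomb G (\<lambda>x. k * c x) S = lincomb G c S [^] (k :: int)"
proof (induction S rule: finite_induct)
  case (insert x S)
  then show ?case
    by (simp add: lincomb_insert int_pow_distrib int_pow_pow mult.commute)
qed simp

lemma (in comm_group) lincomb_uminus:
  assumes "S \<subseteq> carrier G"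
  shows "lincomb G (\<lambda>x. - c x) S = inv (lincomb G c S)"
proof -
  have "lincomb G (\<lambda>x. - c x) S \<otimes> lincomb G c S = \<one>"
    using lincomb_add[OF assms, of "\<lambda>x. - c x" c] by simp
  then show ?thesis using assms by (simp add: inv_equality)
qed

lemma (in comm_group) lincomb_diff:
  "S \<subseteq> carrier G \<Longrightarrow> lincomb G (\<lambda>x. c x - d x) S = lincomb G c S \<otimes> inv (lincomb G d S)"
  using lincomb_add[of S c "\<lambda>x. - d x"] by (simp add: lincomb_uminus)

lemma (in comm_group) lincomb_delta:
  assumes "finite S" "S \<subseteq> carrier G" "a \<in> S"
  shows "lincomb G (\<lambda>x. if x = a then 1 else 0) S = a"
proof -
  have "lincomb G (\<lambda>x. if x = a then 1 else 0) S = finprod G (\<lambda>x. if a = x then x else \<one>) S"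
    unfolding lincomb_def using assms(2) by (intro finprod_cong') auto
  also have "\<dots> = a" using assms by (intro finprod_singleton) auto
  finally show ?thesis .
qed

section \<open>Bounded affine independence and clique bounds\<close>

text \<open>The sum condition makes the property invariant under translations, and the bound \<open>3\<close> is
  what a relation between the differences of three pairs can produce.\<close>
definition affine_indep3 :: "('a, 'm) monoid_scheme \<Rightarrow> int \<Rightarrow> 'a set \<Rightarrow> bool" where
  "affine_indep3 G d S \<longleftrightarrow> (\<forall>c. (\<forall>x\<in>S. \<bar>c x\<bar> \<le> 3) \<and> sum c S = 0 \<and> lincomb G c S = \<one>\<^bsub>G\<^esub> \<longrightarrow>
     (\<forall>x\<in>S. d dvd c x))"

text \<open>Moving all terms of \<open>eq\<close> to one side gives coefficients with sum
  \<open>0\<close>. Each is a sum of three positive and three negative indicators, so it is at most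
  \<open>3\<close> in absolute value.\<close>

lemma (in comm_group) affine_indep3_dvd:
  assumes S: "finite S" "S \<subseteq> carrier G" "affine_indep3 G d S"
    and mem: "i \<in> S" "j \<in> S" "k \<in> S" "l \<in> S" "m \<in> S" "n \<in> S"
    and eq: "i \<otimes> inv j \<otimes> inv (k \<otimes> inv l) = m \<otimes> inv n" and x: "x \<in> S"
  shows "d dvd of_bool (x = i) - of_bool (x = j) - (of_bool (x = k) - of_bool (x = l))
    - (of_bool (x = m) - of_bool (x = n))"
proof -
  define e :: "'a \<Rightarrow> 'a \<Rightarrow> int" where "e a = (\<lambda>x. if x = a then 1 else 0)" for a
  define c where "c x = e i x - e j x - (e k x - e l x) - (e m x - e n x)" for x
  have e: "lincomb G (e a) S = a" "sum (e a) S = 1" if "a \<in> S" for a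
    using lincomb_delta[OF S(1,2) that] S that by (simp_all add: e_def)
  have "lincomb G c S = i \<otimes> inv j \<otimes> inv (k \<otimes> inv l) \<otimes> inv (m \<otimes> inv n)"
    unfolding c_def by (simp only: lincomb_diff[OF S(2)] e mem)
  also have "\<dots> = \<one>" unfolding eq using mem S(2) by (intro r_inv) auto
  finally have "lincomb G c S = \<one>" .
  moreover have "sum c S = 0" unfolding c_def by (simp only: sum_subtractf e mem)
  moreover have "\<bar>c x\<bar> \<le> 3" for x
  proof -
    have "0 \<le> e a x \<and> e a x \<le> 1" for a by (simp add: e_def)
    from this[of i] this[of j] this[of k] this[of l] this[of m] this[of n]
    show ?thesis unfolding c_def by linarith
  qed
  ultimately have "d dvd c x" using S(3) x unfolding affine_indep3_def by blast
  then show ?thesis by (simp only: c_def e_def of_bool_def)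
qed

text \<open>The relation has positive terms \<open>i\<close>, \<open>l\<close>, \<open>n\<close> and
  negative terms \<open>j\<close>, \<open>k\<close>, \<open>m\<close>. If
  \<open>i \<noteq> k\<close> and \<open>j \<noteq> l\<close>, all coefficients can be divisible by
  \<open>3\<close> only for \<open>i = l = n\<close> and \<open>j = k = m\<close>. This is the case
  of reversed pairs, which \<open>card_le_of_pairwise_sharing\<close> allows.\<close>

lemma (in comm_group) clique_bound_indep3:
  assumes S: "finite S" "S \<subseteq> carrier G" "affine_indep3 G d S" "3 dvd d" "card S \<ge> 3"
    and B: "diff_clique G (diffs G S) B"
  shows "finite B \<and> card B \<le> card S"
proof -
  obtain P where P: "P \<subseteq> S \<times> S" "finite B" "card B \<le> Suc (card P)"
    "\<And>i j. (i, j) \<in> P \<Longrightarrow> i \<noteq> j"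
    "\<And>i j k l. (i, j) \<in> P \<Longrightarrow> (k, l) \<in> P \<Longrightarrow> (i, j) \<noteq> (k, l) \<Longrightarrow>
       i \<otimes> inv j \<noteq> k \<otimes> inv l \<and>
       (\<exists>m\<in>S. \<exists>n\<in>S. m \<noteq> n \<and> i \<otimes> inv j \<otimes> inv (k \<otimes> inv l) = m \<otimes> inv n)"
    using diff_clique_diffs_pairs[OF S(1,2) B] by blast
  have "card P \<le> card S - 1"
  proof (rule card_le_of_pairwise_sharing[OF S(1,5) P(1) P(4)])
    fix i j k l assume ij: "(i, j) \<in> P" and kl: "(k, l) \<in> P" and ne: "(i, j) \<noteq> (k, l)"
    obtain m n where mn: "m \<in> S" "n \<in> S" "m \<noteq> n" "i \<otimes> inv j \<otimes> inv (k \<otimes> inv l) = m \<otimes> inv n"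
      using P(5)[OF ij kl ne] by blast
    have mem: "i \<in> S" "j \<in> S" "k \<in> S" "l \<in> S" using ij kl P(1) by auto
    have off: "i \<noteq> j" "k \<noteq> l" using P(4) ij kl by auto
    let ?c = "\<lambda>x. of_bool (x = i) - of_bool (x = j) - (of_bool (x = k) - of_bool (x = l))
      - (of_bool (x = m) - of_bool (x = n)) :: int"
    have c: "3 dvd ?c x" if "x \<in> S" for x
      using affine_indep3_dvd[OF S(1-3) mem mn(1,2,4) that] S(4) dvd_trans by blast
    show "i = k \<or> j = l \<or> (i = l \<and> j = k)"
    proof (rule ccontr)
      assume n: "\<not> ?thesis"
      show False
        using c[OF mem(1)] c[OF mem(2)] c[OF mem(3)] c[OF mem(4)] n off mn(3)
        by (auto simp: of_bool_def split: if_splits)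
    qed
  qed auto
  then show ?thesis using P S(5) by linarith
qed

text \<open>Signs disappear here, so a pair and its reverse give the same difference. Two disjoint
  pairs would produce four odd coefficients, while \<open>m\<close> and \<open>n\<close> can change
  the parity of only two.\<close>

lemma (in comm_group) clique_bound_indep3_exponent_2:
  assumes S: "finite S" "S \<subseteq> carrier G" "affine_indep3 G 2 S" "card S \<ge> 4"
    and S2: "\<And>x. x \<in> S \<Longrightarrow> x \<otimes> x = \<one>"
    and B: "diff_clique G (diffs G S) B"
  shows "finite B \<and> card B \<le> card S"
proof -
  obtain P where P: "P \<subseteq> S \<times> S" "finite B" "card B \<le> Suc (card P)"
    "\<And>i j. (i, j) \<in> P \<Longrightarrow> i \<noteq> j"
    "\<And>i j k l. (i, j) \<in> P \<Longrightarrow> (k, l) \<in> P \<Longrightarrow> (i, j) \<noteq> (k, l) \<Longrightarrow>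
       i \<otimes> inv j \<noteq> k \<otimes> inv l \<and>
       (\<exists>m\<in>S. \<exists>n\<in>S. m \<noteq> n \<and> i \<otimes> inv j \<otimes> inv (k \<otimes> inv l) = m \<otimes> inv n)"
    using diff_clique_diffs_pairs[OF S(1,2) B] by blast
  have inv: "inv x = x" if "x \<in> S" for x
    using S2[OF that] S(2) that by (auto intro: inv_equality)
  have "card P \<le> card S - 1"
  proof (rule card_le_of_intersecting_edges[OF S(1,4) P(1) P(4)])
    show "(j, i) \<notin> P" if ij: "(i, j) \<in> P" for i j
    proof
      assume ji: "(j, i) \<in> P"
      have mem: "i \<in> S" "j \<in> S" using ij P(1) by auto
      then have "i \<otimes> inv j = j \<otimes> inv i" using inv S(2) by (auto simp: m_comm subset_iff)
      then show False using P(5)[OF ij ji] P(4)[OF ij] by auto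
    qed
    fix i j k l assume ij: "(i, j) \<in> P" and kl: "(k, l) \<in> P"
    show "{i, j} \<inter> {k, l} \<noteq> {}"
    proof (cases "(i, j) = (k, l)")
      case ne: False
      obtain m n where mn: "m \<in> S" "n \<in> S" "m \<noteq> n" "i \<otimes> inv j \<otimes> inv (k \<otimes> inv l) = m \<otimes> inv n"
        using P(5)[OF ij kl ne] by blast
      have mem: "i \<in> S" "j \<in> S" "k \<in> S" "l \<in> S" using ij kl P(1) by auto
      have off: "i \<noteq> j" "k \<noteq> l" using P(4) ij kl by auto
      note c = affine_indep3_dvd[OF S(1-3) mem mn(1,2,4)]
      show ?thesis
      proof
        assume n: "{i, j} \<inter> {k, l} = {}"
        then show False
          using c[OF mem(1)] c[OF mem(2)] c[OF mem(3)] c[OF mem(4)] off mn(3)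
          by (auto simp: of_bool_def split: if_splits)
      qed
    qed simp
  qed auto
  then show ?thesis using P S(4) by linarith
qed

text \<open>Greedy construction: a new element only has to avoid finitely many solutions of
  equations whose right-hand sides are bounded combinations of the elements chosen before.\<close>

lemma (in comm_group) exists_affine_indep3:
  assumes H: "H \<subseteq> carrier G" "infinite H" and d: "\<And>x. x \<in> H \<Longrightarrow> x [^] d = \<one>"
    and fin: "\<And>c s. \<bar>c\<bar> \<le> 3 \<Longrightarrow> \<not> d dvd c \<Longrightarrow> finite {x \<in> H. x [^] c = s}"
  shows "\<exists>S\<subseteq>H. finite S \<and> card S = n \<and> affine_indep3 G d S"
proof -
  \<comment> \<open>The induction drops the condition on the coefficient sum, since it does not pass
    from \<open>insert a S\<close> to \<open>S\<close>.\<close>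
  have "\<exists>S\<subseteq>H. finite S \<and> card S = n \<and>
    (\<forall>c. (\<forall>x\<in>S. \<bar>c x\<bar> \<le> 3) \<longrightarrow> lincomb G c S = \<one> \<longrightarrow> (\<forall>x\<in>S. d dvd c x))"
  proof (induction n)
    case 0
    show ?case by (intro exI[of _ "{}"]) simp
  next
    case (Suc n)
    then obtain S where S: "S \<subseteq> H" "finite S" "card S = n"
      "\<And>c x. (\<forall>x\<in>S. \<bar>c x\<bar> \<le> 3) \<Longrightarrow> lincomb G c S = \<one> \<Longrightarrow> x \<in> S \<Longrightarrow> d dvd c x"
      by blast
    have Sc: "S \<subseteq> carrier G" using S H by blast
    define L where "L = {lincomb G c S | c. \<forall>x\<in>S. \<bar>c x\<bar> \<le> 3}"
    have "L \<subseteq> (\<lambda>c. lincomb G c S) ` (S \<rightarrow>\<^sub>E {-3..3})"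
    proof
      fix s assume "s \<in> L"
      then obtain c where c: "s = lincomb G c S" "\<forall>x\<in>S. \<bar>c x\<bar> \<le> 3" by (auto simp: L_def)
      have "s = lincomb G (restrict c S) S" unfolding c(1) by (rule lincomb_cong[OF Sc]) simp
      moreover have "restrict c S \<in> S \<rightarrow>\<^sub>E {-3..3}" using c(2) by (auto simp: abs_le_iff)
      ultimately show "s \<in> (\<lambda>c. lincomb G c S) ` (S \<rightarrow>\<^sub>E {-3..3})" by blast
    qed
    moreover have "finite (S \<rightarrow>\<^sub>E {-3..3::int})" using S(2) by (intro finite_PiE) auto
    ultimately have finL: "finite L" by (meson finite_imageI finite_subset)
    define C where "C = {c::int. \<bar>c\<bar> \<le> 3 \<and> \<not> d dvd c}"
    have finC: "finite C" by (rule finite_subset[of _ "{-3..3}"]) (auto simp: C_def)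
    \<comment> \<open>Outside \<open>Bad\<close>, a bounded relation involving the new element must
      give it a coefficient divisible by \<open>d\<close>. That term vanishes, and a relation on
      \<open>S\<close> is left.\<close>
    define Bad where "Bad = S \<union> (\<Union>c\<in>C. \<Union>s\<in>L. {x \<in> H. x [^] c = s})"
    have "finite Bad" unfolding Bad_def using S(2) finL finC fin by (auto simp: C_def)
    then obtain a where a: "a \<in> H" "a \<notin> Bad" using H(2) by (meson finite_subset subsetI)
    then have aS: "a \<notin> S" and ac: "a \<in> carrier G" using H by (auto simp: Bad_def)
    have "d dvd c x" if c: "\<forall>x\<in>insert a S. \<bar>c x\<bar> \<le> 3" "lincomb G c (insert a S) = \<one>" "x \<in> insert a S" for c x
    proof -
      have eq: "a [^] c a \<otimes> lincomb G c S = \<one>"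
        using c(2) by (simp add: lincomb_insert[OF S(2) aS Sc ac])
      then have "a [^] c a = lincomb G (\<lambda>x. - c x) S"
        using Sc ac by (simp add: lincomb_uminus inv_equality)
      moreover have "lincomb G (\<lambda>x. - c x) S \<in> L"
        unfolding L_def using c(1) by (auto intro!: exI[of _ "\<lambda>x. - c x"])
      ultimately have da: "d dvd c a" using a c(1) by (auto simp: Bad_def C_def)
      then obtain k where k: "c a = d * k" by blast
      have "a [^] c a = \<one>" unfolding k using d[OF a(1)] ac by (simp add: int_pow_pow[symmetric])
      then have "lincomb G c S = \<one>" using eq Sc by simp
      then show ?thesis using S(4)[of c x] c(1,3) da by auto
    qed
    then show ?case using S aS a(1) by (intro exI[of _ "insert a S"]) auto
  qed
  then show ?thesis unfolding affine_indep3_def by blast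
qed

section \<open>Realizing finite packing indices\<close>

text \<open>\<open>S\<close> is itself a clique for \<open>diffs G S\<close>, so only the upper
  bound \<open>max\<close> has to be supplied.\<close>

lemma (in comm_group) realize_by_finite_diffs:
  assumes inf: "infinite (carrier G)" and S: "finite S" "S \<subseteq> carrier G"
    and max: "\<And>B. diff_clique G (diffs G S) B \<Longrightarrow> finite B \<and> card B \<le> card S"
  shows "\<exists>A\<subseteq>carrier G. packing_index G A =o |{..<card S}|"
proof (rule realize_by_clique[OF inf])
  show "diffs G S \<subseteq> carrier G" using S(2) by (auto simp: diffs_def)
  show "inv x \<in> diffs G S" if x: "x \<in> diffs G S" for x
  proof -
    obtain a b where ab: "a \<in> S" "b \<in> S" "x = a \<otimes> inv b" using x by (auto simp: diffs_def)
    then have "inv x = b \<otimes> inv a" using S(2) by (simp add: inv_mult_group subset_iff)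
    then show ?thesis using ab by (auto simp: diffs_def)
  qed
  have "finite (diffs G S)" using S(1) by (simp add: diffs_def)
  then show "|diffs G S| <o |carrier G|" using inf by (simp add: finite_ordLess_infinite2)
  show "diff_clique G (diffs G S) S" using S(2) by (auto simp: diff_clique_def diffs_def)
  show "|S| =o |{..<card S}|"
    using S(1) finite_card_of_iff_card[OF S(1), of "{..<card S}"] by simp
  show "|B| \<le>o |{..<card S}|" if "diff_clique G (diffs G S) B" for B
    using max[OF that] finite_card_of_iff_card2[of B "{..<card S}"] by simp
qed simp

lemma (in group) int_pow_2: "x \<in> carrier G \<Longrightarrow> x [^] (2::int) = x \<otimes> x"
  using int_pow_mult[of x 1 1] by simp

text \<open>A nonempty fibre of multiplication by \<open>c\<close> is a coset of the kernel.\<close>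

lemma (in comm_group) finite_int_pow_fibre:
  assumes "finite {x \<in> carrier G. x [^] (c::int) = \<one>}"
  shows "finite {x \<in> carrier G. x [^] c = s}"
proof (cases "\<exists>y\<in>carrier G. y [^] c = s")
  case True
  then obtain y where y: "y \<in> carrier G" "y [^] c = s" by blast
  have "{x \<in> carrier G. x [^] c = s} \<subseteq> (\<lambda>k. k \<otimes> y) ` {x \<in> carrier G. x [^] c = \<one>}"
  proof
    fix x assume x: "x \<in> {x \<in> carrier G. x [^] c = s}"
    have "s \<in> carrier G" using y by auto
    then have "(x \<otimes> inv y) [^] c = \<one>"
      using x y by (simp add: int_pow_distrib int_pow_inv)
    moreover have "x = x \<otimes> inv y \<otimes> y" using x y by (simp add: m_assoc)
    ultimately show "x \<in> (\<lambda>k. k \<otimes> y) ` {x \<in> carrier G. x [^] c = \<one>}" using x y by auto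
  qed
  then show ?thesis using assms by (meson finite_imageI finite_subset)
next
  case False
  then have "{x \<in> carrier G. x [^] c = s} = {}" by blast
  then show ?thesis by (simp only: finite.emptyI)
qed

text \<open>The independent set is taken in the \<open>2\<close>-torsion with \<open>d = 2\<close>
  if that is infinite, otherwise in the \<open>3\<close>-torsion with \<open>d = 3\<close> if that
  is infinite. Otherwise multiplication by each nonzero \<open>c\<close> with
  \<open>\<bar>c\<bar> \<le> 3\<close> has finite kernel, and \<open>d = 0\<close> works in
  \<open>G\<close> itself.\<close>

lemma (in comm_group) exists_index_finite:
  assumes inf: "infinite (carrier G)" and n: "(n::nat) \<ge> 3"
    and n3: "n = 3 \<Longrightarrow> finite {x \<in> carrier G. x [^] (2::int) = \<one>}"
  shows "\<exists>A\<subseteq>carrier G. packing_index G A =o |{..<n}|"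
proof -
  let ?T = "\<lambda>d::int. {x \<in> carrier G. x [^] d = \<one>}"
  have pow: "x [^] (d * k + r) = x [^] r" if "x \<in> ?T d" for x d k r
    using that by (simp add: int_pow_mult int_pow_pow[symmetric])
  show ?thesis
  proof (cases "finite (?T 2)")
    case inf2: False
    then have n4: "n \<ge> 4" using n n3 by (cases "n = 3") auto
    have "finite {x \<in> ?T 2. x [^] c = s}" if c: "\<bar>c\<bar> \<le> 3" "\<not> 2 dvd c" for c :: int and s
    proof (rule finite_subset[of _ "{s}"])
      have "c = 2 * (c div 2) + 1" using c by presburger
      then have "x [^] c = x" if "x \<in> ?T 2" for x using pow[OF that, of "c div 2" 1] that by simp
      then show "{x \<in> ?T 2. x [^] c = s} \<subseteq> {s}" by auto
    qed simp
    then obtain S where S: "S \<subseteq> ?T 2" "finite S" "card S = n" "affine_indep3 G 2 S"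
      using exists_affine_indep3[of "?T 2" 2 n] inf2 by blast
    have Sc: "S \<subseteq> carrier G" and S2: "\<And>x. x \<in> S \<Longrightarrow> x \<otimes> x = \<one>" using S(1) by (auto simp: int_pow_2)
    show ?thesis
      using realize_by_finite_diffs[OF inf S(2) Sc clique_bound_indep3_exponent_2[OF S(2) Sc S(4) _ S2]]
        n4 S(3) by simp
  next
    case fin2: True
    have "\<exists>d S. 3 dvd d \<and> S \<subseteq> carrier G \<and> finite S \<and> card S = n \<and> affine_indep3 G d S"
    proof (cases "finite (?T 3)")
      case inf3: False
      have "finite {x \<in> ?T 3. x [^] c = s}" if c: "\<bar>c\<bar> \<le> 3" "\<not> 3 dvd c" for c :: int and s
      proof (rule finite_subset[of _ "{s, inv s}"])
        \<comment> \<open>Here \<open>c\<close> is \<open>1\<close> or \<open>-1\<close> modulo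
          \<open>3\<close>, so it acts on the \<open>3\<close>-torsion as the identity or as
          negation.\<close>
        have "c = 3 * (c div 3) + 1 \<or> c = 3 * (c div 3 + 1) + (- 1)" using c by presburger
        then have "x [^] c = x \<or> x [^] c = inv x" if "x \<in> ?T 3" for x
          using pow[OF that, of "c div 3" 1] pow[OF that, of "c div 3 + 1" "-1"] that
          by (auto simp: int_pow_neg)
        then have "x = x [^] c \<or> x = inv (x [^] c)" if "x \<in> ?T 3" for x
          using that by (metis (no_types, lifting) inv_inv mem_Collect_eq)
        then show "{x \<in> ?T 3. x [^] c = s} \<subseteq> {s, inv s}" by blast
      qed simp
      then obtain S where "S \<subseteq> ?T 3" "finite S" "card S = n" "affine_indep3 G 3 S"
        using exists_affine_indep3[of "?T 3" 3 n] inf3 by blast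
      then show ?thesis by (intro exI[of _ 3] exI[of _ S]) auto
    next
      case fin3: True
      have "finite {x \<in> carrier G. x [^] c = s}" if c: "\<bar>c\<bar> \<le> 3" "\<not> 0 dvd c" for c :: int and s
      proof (rule finite_int_pow_fibre)
        have "?T (- c) = ?T c" by (auto simp: int_pow_neg)
        moreover have "?T 1 \<subseteq> {\<one>}" by auto
        then have "finite (?T 1)" by (rule finite_subset) simp
        moreover have "c \<in> {1, 2, 3} \<or> - c \<in> {1, 2, 3}" using c by auto
        ultimately show "finite (?T c)" using fin2 fin3 by auto
      qed
      then obtain S where "S \<subseteq> carrier G" "finite S" "card S = n" "affine_indep3 G 0 S"
        using exists_affine_indep3[of "carrier G" 0 n] inf by auto
      then show ?thesis by (intro exI[of _ 0] exI[of _ S]) auto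
    qed
    then obtain d S where S: "3 dvd d" "S \<subseteq> carrier G" "finite S" "card S = n" "affine_indep3 G d S"
      by blast
    show ?thesis
      using realize_by_finite_diffs[OF inf S(3,2) clique_bound_indep3[OF S(3,2,5,1)]] n S(4) by simp
  qed
qed

text \<open>Take \<open>S = {0, g}\<close>. A larger clique would yield both \<open>g\<close> and
  \<open>-g\<close> after translation; their difference \<open>2g\<close> would then be
  \<open>g\<close> or \<open>-g\<close>, contrary to \<open>g \<noteq> 0\<close> and
  \<open>3g \<noteq> 0\<close>.\<close>

lemma (in comm_group) exists_index_two:
  assumes inf: "infinite (carrier G)" and g: "g \<in> carrier G" "g [^] (3::int) \<noteq> \<one>"
  shows "\<exists>A\<subseteq>carrier G. packing_index G A =o |{..<2::nat}|"
proof -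
  let ?S = "{\<one>, g}"
  have g1: "g \<noteq> \<one>" using g by auto
  have S: "finite ?S" "?S \<subseteq> carrier G" "card ?S = 2" using g g1 by auto
  have pow3: "g [^] (3::int) = g \<otimes> (g \<otimes> g)"
    using int_pow_mult[OF g(1), of 1 2] g(1) by (simp add: int_pow_2)
  have "finite B \<and> card B \<le> 2" if B: "diff_clique G (diffs G ?S) B" for B
  proof -
    obtain P where P: "P \<subseteq> ?S \<times> ?S" "finite B" "card B \<le> Suc (card P)"
      "\<And>i j. (i, j) \<in> P \<Longrightarrow> i \<noteq> j"
      "\<And>i j k l. (i, j) \<in> P \<Longrightarrow> (k, l) \<in> P \<Longrightarrow> (i, j) \<noteq> (k, l) \<Longrightarrow>
         i \<otimes> inv j \<noteq> k \<otimes> inv l \<and>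
         (\<exists>m\<in>?S. \<exists>n\<in>?S. m \<noteq> n \<and> i \<otimes> inv j \<otimes> inv (k \<otimes> inv l) = m \<otimes> inv n)"
      using diff_clique_diffs_pairs[OF S(1,2) B] by blast
    have "\<not> ((\<one>, g) \<in> P \<and> (g, \<one>) \<in> P)"
    proof
      assume "(\<one>, g) \<in> P \<and> (g, \<one>) \<in> P"
      then have "g \<otimes> g = g \<or> g \<otimes> g = inv g" using P(5)[of g \<one> \<one> g] g g1 by auto
      then show False using g g1 pow3 by (auto simp: r_cancel_one)
    qed
    moreover have "P \<subseteq> {(\<one>, g), (g, \<one>)}" using P(1,4) by fastforce
    ultimately have "P \<subseteq> {(\<one>, g)} \<or> P \<subseteq> {(g, \<one>)}" by blast
    then have "card P \<le> 1"
      using card_mono[of "{(\<one>, g)}" P] card_mono[of "{(g, \<one>)}" P] by auto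
    then show ?thesis using P by linarith
  qed
  then show ?thesis using realize_by_finite_diffs[OF inf S(1,2)] S(3) by simp
qed

text \<open>Take \<open>S = {0, a, b}\<close>. The coefficient of the neutral element does not
  affect the combination, but the sum condition makes it \<open>-(p + q)\<close>; this is the origin
  of the bound on \<open>p + q\<close>.\<close>

lemma (in comm_group) exists_index_three_of_pair:
  assumes inf: "infinite (carrier G)" and ab: "a \<in> carrier G" "b \<in> carrier G"
    and ind: "\<And>p q::int. \<bar>p\<bar> \<le> 3 \<Longrightarrow> \<bar>q\<bar> \<le> 3 \<Longrightarrow> \<bar>p + q\<bar> \<le> 3 \<Longrightarrow>
      a [^] p \<otimes> b [^] q = \<one> \<Longrightarrow> p = 0 \<and> q = 0"
  shows "\<exists>A\<subseteq>carrier G. packing_index G A =o |{..<3::nat}|"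
proof -
  have ne: "a \<noteq> \<one>" "b \<noteq> \<one>" "a \<noteq> b"
  proof -
    show "a \<noteq> \<one>" using ind[of 1 0] ab by auto
    show "b \<noteq> \<one>" using ind[of 0 1] ab by auto
    have "a [^] (1::int) \<otimes> b [^] (-1::int) = \<one>" if "a = b"
      using ab that int_pow_mult[of b 1 "-1"] by simp
    then show "a \<noteq> b" using ind[of 1 "-1"] by auto
  qed
  let ?S = "{\<one>, a, b}"
  have S: "finite ?S" "?S \<subseteq> carrier G" "card ?S = 3" using ab ne by auto
  have "affine_indep3 G 0 ?S"
    unfolding affine_indep3_def
  proof (intro allI impI)
    fix c assume c: "(\<forall>x\<in>?S. \<bar>c x\<bar> \<le> 3) \<and> sum c ?S = 0 \<and> lincomb G c ?S = \<one>"
    have "lincomb G c ?S = \<one> [^] c \<one> \<otimes> (a [^] c a \<otimes> (b [^] c b \<otimes> \<one>))"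
      using lincomb_insert[of "{a, b}" \<one> c] lincomb_insert[of "{b}" a c]
        lincomb_insert[of "{}" b c] ab ne ne[symmetric] by simp
    then have "a [^] c a \<otimes> b [^] c b = \<one>" using c ab by simp
    moreover have c1: "c \<one> = - (c a + c b)" using c ne ne[symmetric] by simp
    moreover have bd: "\<bar>c \<one>\<bar> \<le> 3" "\<bar>c a\<bar> \<le> 3" "\<bar>c b\<bar> \<le> 3" using c by simp_all
    moreover have "\<bar>c a + c b\<bar> \<le> 3" using bd(1) unfolding c1 by linarith
    ultimately have "c a = 0 \<and> c b = 0" by (intro ind)
    then show "\<forall>x\<in>?S. 0 dvd c x" using c1 by simp
  qed
  then show ?thesis
    using realize_by_finite_diffs[OF inf S(1,2) clique_bound_indep3[OF S(1,2)]] S(3) by simp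
qed

lemma (in group) int_pow_order_2:
  assumes "t \<in> carrier G" "t [^] (2::int) = \<one>"
  shows "t [^] (q::int) = (if even q then \<one> else t)"
proof -
  have "t [^] q = t [^] (2 * (q div 2) + q mod 2)" by simp
  also have "\<dots> = t [^] (q mod 2)" using assms by (simp only: int_pow_mult) (simp add: int_pow_pow[symmetric])
  finally show ?thesis using assms by (auto simp: even_iff_mod_2_eq_zero odd_iff_mod_2_eq_one)
qed

text \<open>With infinite \<open>2\<close>-torsion, \<open>S = {0, g, t - g}\<close> works if \<open>kg \<noteq> 0\<close> for \<open>1 \<le> k \<le> 5\<close> and \<open>t\<close> is a generic
  element of order \<open>2\<close>. If there is no such \<open>g\<close>, then \<open>G\<close> has exponent \<open>4\<close>, and \<open>S = {0, a, b}\<close> works because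
  \<open>a, b\<close> are independent modulo \<open>4\<close>.\<close>
lemma (in comm_group) exists_index_three:
  assumes inf: "infinite (carrier G)" and ab: "a \<in> carrier G" "b \<in> carrier G"
    "a [^] (2::int) \<noteq> \<one>" "b [^] (2::int) \<noteq> \<one>" "a [^] (2::int) \<noteq> b [^] (2::int)"
  shows "\<exists>A\<subseteq>carrier G. packing_index G A =o |{..<3::nat}|"
proof (cases "finite {x \<in> carrier G. x [^] (2::int) = \<one>}")
  case True
  then show ?thesis by (intro exists_index_finite[OF inf]) auto
next
  case inf2: False
  show ?thesis
  proof (cases "\<exists>g\<in>carrier G. \<forall>k\<in>{1..5::int}. g [^] k \<noteq> \<one>")
    case True
    then obtain g where g: "g \<in> carrier G" "\<And>k::int. 1 \<le> k \<Longrightarrow> k \<le> 5 \<Longrightarrow> g [^] k \<noteq> \<one>" by auto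
    have g0: "k = 0" if k: "g [^] k = \<one>" "\<bar>k\<bar> \<le> 5" for k :: int
    proof (rule ccontr)
      assume "k \<noteq> 0"
      moreover have "g [^] (- k) = \<one>" using k g(1) by (simp add: int_pow_neg)
      ultimately show False using g(2)[of k] g(2)[of "- k"] k by linarith
    qed
    \<comment> \<open>The range \<open>{-6..6}\<close> contains all \<open>q - p\<close> with
      \<open>p\<close>, \<open>q\<close> bounded by \<open>3\<close>.\<close>
    have "finite ((\<lambda>k::int. g [^] k) ` {-6..6})" by simp
    then obtain t where "t \<in> {x \<in> carrier G. x [^] (2::int) = \<one>}" "t \<notin> (\<lambda>k::int. g [^] k) ` {-6..6}"
      using inf2 by (meson finite_subset subsetI)
    then have t: "t \<in> carrier G" "t [^] (2::int) = \<one>" "\<And>k::int. k \<in> {-6..6} \<Longrightarrow> t \<noteq> g [^] k"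
      by blast+
    show ?thesis
    proof (rule exists_index_three_of_pair[OF inf g(1), of "inv g \<otimes> t"])
      show "inv g \<otimes> t \<in> carrier G" using g t by simp
      fix p q :: int
      assume pq: "\<bar>p\<bar> \<le> 3" "\<bar>q\<bar> \<le> 3" "\<bar>p + q\<bar> \<le> 3" and eq: "g [^] p \<otimes> (inv g \<otimes> t) [^] q = \<one>"
      \<comment> \<open>The relation \<open>p g + q (t - g) = 0\<close> is regrouped. For odd
        \<open>q\<close> it would make \<open>t\<close> a small multiple of
        \<open>g\<close>.\<close>
      have "g [^] (p - q) \<otimes> t [^] q = \<one>"
        using eq g(1) t(1) by (simp add: int_pow_distrib int_pow_inv int_pow_diff m_assoc)
      then have eq': "g [^] (p - q) \<otimes> (if even q then \<one> else t) = \<one>" using t by (simp add: int_pow_order_2)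
      have "even q"
      proof (rule ccontr)
        assume "odd q"
        then have "t \<otimes> g [^] (p - q) = \<one>" using eq' g t by (simp add: m_comm)
        then have "t = g [^] (- (p - q))" using g(1) t(1) int_pow_neg[OF g(1), of "p - q"]
          by (simp add: inv_equality)
        moreover have "- (p - q) \<in> {-6..6}" using pq by auto
        ultimately show False using t(3) by blast
      qed
      then obtain r where r: "q = 2 * r" by (elim evenE)
      have "g [^] (p - q) = \<one>" using eq' \<open>even q\<close> g by simp
      \<comment> \<open>An even \<open>q\<close> satisfies \<open>\<bar>q\<bar> \<le> 2\<close>.
        Once \<open>p = q\<close> is known, \<open>p + q\<close> is a multiple of \<open>4\<close>
        of absolute value at most \<open>3\<close>, hence \<open>0\<close>.\<close>
      moreover have "\<bar>p - q\<bar> \<le> 5" using pq r by presburger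
      ultimately have "p - q = 0" by (rule g0)
      then show "p = 0 \<and> q = 0" using pq r by presburger
    qed
  next
    case False
    then have no: "\<exists>k\<in>{1..5::int}. g [^] k = \<one>" if "g \<in> carrier G" for g using that by blast
    have five: "k = 1 \<or> k = 2 \<or> k = 3 \<or> k = 4 \<or> k = 5" if "k \<in> {1..5::int}" for k using that by auto
    have "\<not> {x \<in> carrier G. x [^] (2::int) = \<one>} \<subseteq> {\<one>}" using inf2 finite_subset by blast
    then obtain t where t: "t \<in> carrier G" "t [^] (2::int) = \<one>" "t \<noteq> \<one>" by blast
    \<comment> \<open>If \<open>4x \<noteq> 0\<close>, then \<open>x\<close> is killed by
      \<open>3\<close> or \<open>5\<close>. Adding \<open>t\<close>, of order \<open>2\<close>,
      gives an element that no number from \<open>1\<close> to \<open>5\<close> kills.\<close>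
    have exp4: "x [^] (4::int) = \<one>" if x: "x \<in> carrier G" for x
    proof (rule ccontr)
      assume x4: "x [^] (4::int) \<noteq> \<one>"
      have dbl: "x [^] (2 * k) = \<one>" if "x [^] k \<otimes> t = \<one>" for k :: int
      proof -
        have "(x [^] k \<otimes> t) [^] (2::int) = x [^] (2 * k)"
          using x t by (simp add: int_pow_distrib int_pow_pow mult.commute)
        then show ?thesis using that by simp
      qed
      have x2: "x [^] (2::int) \<noteq> \<one>" using x4 int_pow_pow[OF x, of 2 2] by auto
      have x1: "x \<noteq> \<one>" using x2 by auto
      have xt: "(x \<otimes> t) [^] k = x [^] k \<otimes> (if even k then \<one> else t)" for k :: int
        using x t by (simp add: int_pow_distrib int_pow_order_2)
      obtain k :: int where k: "k \<in> {1..5}" "x [^] k = \<one>" using no[OF x] by blast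
      then have k35: "k = 3 \<or> k = 5" using five[OF k(1)] x x1 x2 x4 by auto
      obtain l :: int where l: "l \<in> {1..5}" "(x \<otimes> t) [^] l = \<one>" using no[of "x \<otimes> t"] x t by auto
      have "even l \<Longrightarrow> x [^] l = \<one>" "odd l \<Longrightarrow> x [^] l \<otimes> t = \<one>" using l xt[of l] x by simp_all
      moreover have "l \<noteq> 2" "l \<noteq> 4" "l \<noteq> 1" using calculation x2 x4 dbl[of 1] by auto
      ultimately have l35: "l = 3 \<or> l = 5" and lt: "x [^] l \<otimes> t = \<one>"
        using five[OF l(1)] by auto
      show False
      proof (cases "l = k")
        case True
        then show False using lt k(2) t by simp
      next
        case False
        have "x [^] (2 * l) = \<one>" by (rule dbl[OF lt])
        \<comment> \<open>As \<open>k\<close> and \<open>l\<close> are \<open>3\<close> and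
          \<open>5\<close> in some order, reducing \<open>2l\<close> modulo \<open>k\<close> turns
          \<open>2l x = 0\<close> into \<open>4x = 0\<close> or \<open>x = 0\<close>.\<close>
        moreover have "2 * l = k * 2 + 4 \<or> 2 * l = k * 1 + 1" using k35 l35 False by auto
        ultimately have "x [^] (k * 2 + 4) = \<one> \<or> x [^] (k * 1 + 1) = \<one>" by metis
        then show False using k(2) x x1 x4 by (auto simp: int_pow_mult int_pow_pow[symmetric])
      qed
    qed
    have indep2: "even p \<and> even q"
      if A: "A \<in> carrier G" "A [^] (2::int) = \<one>" "B \<in> carrier G" "B [^] (2::int) = \<one>"
        "A \<noteq> \<one>" "B \<noteq> \<one>" "A \<noteq> B" "A [^] p \<otimes> B [^] q = \<one>" for A B and p q :: int
    proof -
      have "B \<otimes> B = \<one>" using A(3,4) by (simp add: int_pow_2)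
      then have "A \<otimes> B \<noteq> \<one>" using A(1,3,7) by (metis r_cancel)
      moreover have "(if even p then \<one> else A) \<otimes> (if even q then \<one> else B) = \<one>"
        using A(8) by (simp only: int_pow_order_2[OF A(1,2)] int_pow_order_2[OF A(3,4)])
      ultimately show ?thesis
        using A(1,3,5,6) by (cases "even p"; cases "even q") simp_all
    qed
    let ?A = "a [^] (2::int)" and ?B = "b [^] (2::int)"
    have AB: "?A \<in> carrier G" "?A [^] (2::int) = \<one>" "?B \<in> carrier G" "?B [^] (2::int) = \<one>"
      using ab exp4 by (simp_all add: int_pow_pow)
    show ?thesis
    proof (rule exists_index_three_of_pair[OF inf ab(1,2)])
      fix p q :: int
      assume pq: "\<bar>p\<bar> \<le> 3" "\<bar>q\<bar> \<le> 3" "\<bar>p + q\<bar> \<le> 3" and eq: "a [^] p \<otimes> b [^] q = \<one>"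
      \<comment> \<open>Doubling the relation shows that \<open>p\<close> and \<open>q\<close> are
        even. The original relation is then one between \<open>2a\<close> and \<open>2b\<close> with
        halved coefficients, which are even as well. So \<open>4\<close> divides \<open>p\<close>
        and \<open>q\<close>, and the bound \<open>3\<close> makes them zero.\<close>
      have "?A [^] p \<otimes> ?B [^] q = (a [^] p \<otimes> b [^] q) [^] (2::int)"
        using ab by (simp add: int_pow_distrib int_pow_pow mult.commute)
      then have "even p \<and> even q" using indep2[OF AB ab(3,4,5), of p q] eq by simp
      then obtain r s where rs: "p = 2 * r" "q = 2 * s" by (elim evenE conjE)
      have "?A [^] r \<otimes> ?B [^] s = \<one>" using eq ab by (simp add: rs int_pow_pow)
      then have "even r \<and> even s" by (rule indep2[OF AB ab(3,4,5)])
      then show "p = 0 \<and> q = 0" using pq rs by presburger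
    qed
  qed
qed

subsection \<open>Abelian groups of prime exponent\<close>

text \<open>On elements killed by a prime \<open>p\<close> this is linear independence over the
  field with \<open>p\<close> elements; vanishing of a coefficient becomes divisibility of an
  integer by \<open>p\<close>.\<close>

definition lin_indep :: "('a, 'm) monoid_scheme \<Rightarrow> int \<Rightarrow> 'a set \<Rightarrow> bool" where
  "lin_indep G p I \<longleftrightarrow> I \<subseteq> carrier G \<and> (\<forall>J c. finite J \<and> J \<subseteq> I \<and> lincomb G c J = \<one>\<^bsub>G\<^esub> \<longrightarrow> (\<forall>x\<in>J. p dvd c x))"

lemma lin_indepD:
  "lin_indep G p I \<Longrightarrow> finite J \<Longrightarrow> J \<subseteq> I \<Longrightarrow> lincomb G c J = \<one>\<^bsub>G\<^esub> \<Longrightarrow> x \<in> J \<Longrightarrow> p dvd c x"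
  unfolding lin_indep_def by blast

lemma (in group) int_pow_mod:
  assumes "x \<in> carrier G" "x [^] (p::int) = \<one>"
  shows "x [^] (k mod p) = x [^] k"
proof -
  have "x [^] k = x [^] (p * (k div p) + k mod p)" by simp
  also have "\<dots> = (x [^] p) [^] (k div p) \<otimes> x [^] (k mod p)"
    using assms(1) by (simp only: int_pow_mult int_pow_pow)
  finally show ?thesis using assms by simp
qed

text \<open>Zorn's lemma gives a maximal independent set above \<open>S\<close>. If adding
  \<open>h\<close> destroys independence, the resulting relation involves \<open>h\<close> with a
  coefficient prime to \<open>p\<close>, so it can be solved for \<open>h\<close>.\<close>

lemma (in comm_group) exists_basis:
  assumes H: "H \<subseteq> carrier G" "\<And>x. x \<in> H \<Longrightarrow> x [^] p = \<one>" and p: "Factorial_Ring.prime (p::int)"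
    and S: "S \<subseteq> H" "lin_indep G p S"
  obtains I where "S \<subseteq> I" "I \<subseteq> H" "lin_indep G p I"
    "\<And>h. h \<in> H \<Longrightarrow> \<exists>J c. finite J \<and> J \<subseteq> I \<and> h = lincomb G c J"
proof -
  define \<A> where "\<A> = {I. S \<subseteq> I \<and> I \<subseteq> H \<and> lin_indep G p I}"
  have "\<exists>M\<in>\<A>. \<forall>I\<in>\<A>. M \<subseteq> I \<longrightarrow> I = M"
  proof (rule subset_Zorn_nonempty)
    show "\<A> \<noteq> {}" using S by (auto simp: \<A>_def)
    show "\<Union>\<C> \<in> \<A>" if \<C>: "\<C> \<noteq> {}" "subset.chain \<A> \<C>" for \<C>
    proof -
      have CA: "\<C> \<subseteq> \<A>" using \<C>(2) by (simp add: subset.chain_def)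
      have "lin_indep G p (\<Union>\<C>)"
        unfolding lin_indep_def
      proof (intro conjI allI impI)
        show "\<Union>\<C> \<subseteq> carrier G" using CA H(1) by (auto simp: \<A>_def)
        fix J c assume J: "finite J \<and> J \<subseteq> \<Union>\<C> \<and> lincomb G c J = \<one>"
        then obtain I where "I \<in> \<C>" "J \<subseteq> I"
          using finite_subset_Union_chain[OF _ _ \<C>, of J] by blast
        then show "\<forall>x\<in>J. p dvd c x" using J CA lin_indepD[of G p I J c] by (auto simp: \<A>_def)
      qed
      moreover have "S \<subseteq> \<Union>\<C>" "\<Union>\<C> \<subseteq> H" using \<C>(1) CA by (auto simp: \<A>_def)
      ultimately show ?thesis by (simp add: \<A>_def)
    qed
  qed
  then obtain I where I: "S \<subseteq> I" "I \<subseteq> H" "lin_indep G p I"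
    and max: "\<And>I'. S \<subseteq> I' \<Longrightarrow> I' \<subseteq> H \<Longrightarrow> lin_indep G p I' \<Longrightarrow> I \<subseteq> I' \<Longrightarrow> I' = I"
    by (auto simp: \<A>_def)
  have Ic: "I \<subseteq> carrier G" using I H by blast
  have "\<exists>J c. finite J \<and> J \<subseteq> I \<and> h = lincomb G c J" if h: "h \<in> H" for h
  proof (cases "h \<in> I")
    case True
    then have "h = lincomb G (\<lambda>x. if x = h then 1 else 0) {h}"
      using Ic by (intro lincomb_delta[symmetric]) auto
    then show ?thesis using True by (intro exI[of _ "{h}"]) auto
  next
    case False
    have hc: "h \<in> carrier G" using h H by blast
    have "\<not> lin_indep G p (insert h I)" using max[of "insert h I"] I h False by blast
    then obtain J c y where J: "finite J" "J \<subseteq> insert h I" "lincomb G c J = \<one>" "y \<in> J" "\<not> p dvd c y"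
      using Ic hc unfolding lin_indep_def by auto
    define K where "K = J - {h}"
    have K: "finite K" "K \<subseteq> I" "h \<notin> K" "K \<subseteq> carrier G" using J Ic by (auto simp: K_def)
    have hJ: "h \<in> J" using J lin_indepD[OF I(3) J(1) _ J(3,4)] by blast
    then have "insert h K = J" by (auto simp: K_def)
    then have eq: "h [^] c h \<otimes> lincomb G c K = \<one>" using lincomb_insert[OF K(1,3,4) hc, of c] J(3) by simp
    have "\<not> p dvd c h"
    proof
      assume d: "p dvd c h"
      then obtain k where "c h = p * k" by blast
      then have "h [^] c h = \<one>" using H(2)[OF h] hc by (simp add: int_pow_pow[symmetric])
      then have "lincomb G c K = \<one>" using eq K by simp
      then show False using lin_indepD[OF I(3) K(1,2), of c y] J(4,5) d by (auto simp: K_def)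
    qed
    then have "coprime p (c h)" using p by (intro prime_imp_coprime)
    \<comment> \<open>\<open>v\<close> is an inverse of \<open>c h\<close> modulo
      \<open>p\<close>.\<close>
    then obtain u v where uv: "u * p + v * c h = 1" using bezout_int[of p "c h"] by (metis coprime_imp_gcd_eq_1)
    have hch: "h [^] c h = lincomb G (\<lambda>x. - c x) K"
      using eq K hc by (simp add: lincomb_uminus inv_equality)
    have "h = h [^] (p * u + c h * v)" using hc uv by (simp add: mult.commute)
    also have "\<dots> = (h [^] p) [^] u \<otimes> (h [^] c h) [^] v" using hc by (simp only: int_pow_mult int_pow_pow)
    also have "\<dots> = (h [^] c h) [^] v" using H(2)[OF h] hc by simp
    also have "\<dots> = lincomb G (\<lambda>x. v * (- c x)) K" unfolding hch using K by (simp only: lincomb_mult)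
    finally show ?thesis using K by blast
  qed
  with I show ?thesis by (intro that)
qed

text \<open>\<open>\<psi>\<close> is the map from the direct sum induced by the inclusion of
  \<open>I\<close>. It respects reduction modulo \<open>p\<close> because \<open>p\<close> kills
  \<open>I\<close>. Both isomorphism results below use it; \<open>lin_map_eq\<close> passes from the
  possibly infinite \<open>I\<close> to a finite set containing the support.\<close>

lemma (in comm_group) lin_map_props:
  assumes I: "I \<subseteq> carrier G" "\<forall>x\<in>I. x [^] int p = \<one>" and p: "p > 0"
  defines "\<psi> \<equiv> (\<lambda>x. gfinprod G (\<lambda>i. i [^] (x i :: int)) I)"
    and "SG \<equiv> sum_group I (\<lambda>_. integer_mod_group p)"
  shows lin_map_hom: "\<psi> \<in> hom SG G"
    and lin_map_eq: "\<And>x. x \<in> carrier SG \<Longrightarrow> J \<subseteq> I \<Longrightarrow> finite J \<Longrightarrow> (\<And>i. i \<in> I - J \<Longrightarrow> x i = 0) \<Longrightarrow>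
        \<psi> x = lincomb G x J"
    and lin_map_surj: "\<And>J c. finite J \<Longrightarrow> J \<subseteq> I \<Longrightarrow> \<exists>x\<in>carrier SG. \<psi> x = lincomb G c J"
proof -
  have car: "carrier SG = {x \<in> I \<rightarrow>\<^sub>E {0..<int p}. finite {i \<in> I. x i \<noteq> 0}}"
    using p by (simp add: SG_def carrier_sum_group carrier_integer_mod_group)
  show "\<psi> \<in> hom SG G"
    unfolding \<psi>_def SG_def
  proof (rule hom_group_sum)
    show "(\<lambda>z. i [^] z) \<in> hom (integer_mod_group p) G" if "i \<in> I" for i
      using that I by (intro homI) (auto simp: int_pow_mod int_pow_mult)
  qed simp
  have eq: "\<psi> x = lincomb G x J"
    if "x \<in> carrier SG" "J \<subseteq> I" "finite J" "\<And>i. i \<in> I - J \<Longrightarrow> x i = 0" for x J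
  proof -
    have "\<psi> x = gfinprod G (\<lambda>i. i [^] x i) J"
      unfolding \<psi>_def using that I(1) by (intro gfinprod_mono_neutral_cong_right) auto
    also have "\<dots> = lincomb G x J"
      unfolding lincomb_def using that I(1) by (intro gfinprod_eq_finprod) auto
    finally show ?thesis .
  qed
  then show "\<And>x. x \<in> carrier SG \<Longrightarrow> J \<subseteq> I \<Longrightarrow> finite J \<Longrightarrow> (\<And>i. i \<in> I - J \<Longrightarrow> x i = 0) \<Longrightarrow>
        \<psi> x = lincomb G x J" .
  show "\<exists>x\<in>carrier SG. \<psi> x = lincomb G c J" if J: "finite J" "J \<subseteq> I" for J c
  proof -
    define x where "x = (\<lambda>i\<in>I. if i \<in> J then c i mod int p else 0)"
    have "finite {i \<in> I. x i \<noteq> 0}" by (rule finite_subset[OF _ J(1)]) (auto simp: x_def split: if_splits)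
    then have x: "x \<in> carrier SG" using p by (auto simp: car x_def)
    have "\<psi> x = lincomb G x J" using J by (intro eq x) (auto simp: x_def)
    also have "\<dots> = lincomb G c J"
      unfolding lincomb_def using J I by (intro finprod_cong') (auto simp: x_def int_pow_mod subset_iff)
    finally show ?thesis using x by blast
  qed
qed

text \<open>For a basis \<open>I\<close>, independence makes the map of \<open>lin_map_props\<close>
  injective and the spanning property makes it surjective.\<close>

lemma (in comm_group) iso_direct_sum_of_prime_exponent:
  assumes p: "Factorial_Ring.prime p" and exp: "\<And>x. x \<in> carrier G \<Longrightarrow> x [^] int p = \<one>"
  shows "iso_direct_sum G p"
proof -
  have pp: "Factorial_Ring.prime (int p)" "p > 0" using p prime_gt_0_nat by auto
  have "lin_indep G (int p) {}" by (simp add: lin_indep_def)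
  then obtain I where I: "I \<subseteq> carrier G" "lin_indep G (int p) I"
    and span: "\<And>h. h \<in> carrier G \<Longrightarrow> \<exists>J c. finite J \<and> J \<subseteq> I \<and> h = lincomb G c J"
    using exists_basis[of "carrier G" "int p" "{}"] exp pp by auto
  have expI: "\<forall>x\<in>I. x [^] int p = \<one>" using I exp by blast
  let ?\<psi> = "\<lambda>x. gfinprod G (\<lambda>i. i [^] (x i :: int)) I"
  let ?SG = "sum_group I (\<lambda>_. integer_mod_group p)"
  note eq = lin_map_eq[OF I(1) expI pp(2)]
  have car: "carrier ?SG = {x \<in> I \<rightarrow>\<^sub>E {0..<int p}. finite {i \<in> I. x i \<noteq> 0}}"
    using pp(2) by (simp add: carrier_sum_group carrier_integer_mod_group)
  have "inj_on ?\<psi> (carrier ?SG)"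
  proof (rule inj_onI)
    fix x y assume xy: "x \<in> carrier ?SG" "y \<in> carrier ?SG" "?\<psi> x = ?\<psi> y"
    define J where "J = {i \<in> I. x i \<noteq> 0} \<union> {i \<in> I. y i \<noteq> 0}"
    have J: "finite J" "J \<subseteq> I" "J \<subseteq> carrier G" using xy I by (auto simp: J_def car)
    have "lincomb G x J = lincomb G y J"
      using xy eq[OF xy(1) J(2,1)] eq[OF xy(2) J(2,1)] by (auto simp: J_def)
    then have "lincomb G (\<lambda>i. x i - y i) J = \<one>" using J by (simp add: lincomb_diff)
    then have dvd: "int p dvd x i - y i" if "i \<in> J" for i using lin_indepD[OF I(2) J(1,2)] that by blast
    have "x i = y i" if i: "i \<in> I" for i
    proof (cases "i \<in> J")
      case True
      have "x i mod int p = y i mod int p" using dvd[OF True] by (simp add: mod_eq_dvd_iff)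
      moreover have "x i \<in> {0..<int p}" "y i \<in> {0..<int p}" using xy i by (auto simp: car)
      ultimately show ?thesis by simp
    qed (use i in \<open>simp add: J_def\<close>)
    then show "x = y" using xy by (intro PiE_ext[of x I _ y]) (auto simp: car)
  qed
  moreover have "?\<psi> ` carrier ?SG = carrier G"
  proof
    show "?\<psi> ` carrier ?SG \<subseteq> carrier G"
      using lin_map_hom[OF I(1) expI pp(2)] by (auto simp: hom_def)
    show "carrier G \<subseteq> ?\<psi> ` carrier ?SG"
    proof
      fix h assume "h \<in> carrier G"
      then obtain J c where J: "finite J" "J \<subseteq> I" "h = lincomb G c J" using span by blast
      obtain x where "x \<in> carrier ?SG" "?\<psi> x = lincomb G c J"
        using lin_map_surj[OF I(1) expI pp(2) J(1,2)] by blast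
      then show "h \<in> ?\<psi> ` carrier ?SG" using J(3) by (intro image_eqI[of _ _ x]) simp_all
    qed
  qed
  ultimately have "?\<psi> \<in> iso ?SG G"
    using lin_map_hom[OF I(1) expI pp(2)] by (simp add: iso_def bij_betw_def)
  then have "?SG \<cong> G" unfolding is_iso_def by blast
  then have "G \<cong> ?SG" by (rule group.iso_sym[rotated]) simp
  then show ?thesis unfolding iso_direct_sum_def by blast
qed

text \<open>By \<open>sq\<close>, the doubles are exactly \<open>0\<close> and
  \<open>t = 2g\<close>. A basis of the \<open>2\<close>-torsion is chosen to contain
  \<open>t\<close>; replacing \<open>t\<close> by \<open>g\<close> gives the summand of order
  \<open>4\<close>, and the other basis elements give the copies of the group of order
  \<open>2\<close>.\<close>

lemma (in comm_group) iso_Z4_plus_direct_sum_Z2_of_squares: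
  assumes g: "g \<in> carrier G" "g [^] (2::int) \<noteq> \<one>"
    and sq: "\<And>x. x \<in> carrier G \<Longrightarrow> x [^] (2::int) = \<one> \<or> x [^] (2::int) = g [^] (2::int)"
  shows "iso_Z4_plus_direct_sum_Z2 G"
proof -
  define t where "t = g [^] (2::int)"
  have t: "t \<in> carrier G" "t \<noteq> \<one>" using g by (auto simp: t_def)
  have "t [^] (2::int) \<noteq> t" using t by (simp add: int_pow_2)
  then have t2: "t [^] (2::int) = \<one>" using sq[OF t(1)] by (simp add: t_def)
  then have g4: "g [^] (4::int) = \<one>" using int_pow_pow[OF g(1), of 2 2] by (simp add: t_def)
  define H where "H = {x \<in> carrier G. x [^] (2::int) = \<one>}"
  have tc: "lincomb G c {t} = t [^] c t" for c using lincomb_insert[of "{}" t c] t by simp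
  have li: "lin_indep G 2 {t}"
    unfolding lin_indep_def
  proof (intro conjI allI impI)
    fix J c assume J: "finite J \<and> J \<subseteq> {t} \<and> lincomb G c J = \<one>"
    then have "J = {} \<or> J = {t}" by auto
    moreover have "even (c t)" if "J = {t}"
      using J that tc[of c] int_pow_order_2[OF t(1) t2, of "c t"] t(2) by (metis (full_types))
    ultimately show "\<forall>x\<in>J. 2 dvd c x" by blast
  qed (use t in simp)
  obtain I0 where I0: "{t} \<subseteq> I0" "I0 \<subseteq> H" "lin_indep G 2 I0"
    and span: "\<And>h. h \<in> H \<Longrightarrow> \<exists>J c. finite J \<and> J \<subseteq> I0 \<and> h = lincomb G c J"
  proof (rule exists_basis[of H 2 "{t}"])
    show "H \<subseteq> carrier G" "{t} \<subseteq> H" using t t2 by (auto simp: H_def)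
    show "x [^] (2::int) = \<one>" if "x \<in> H" for x using that by (simp add: H_def)
    show "Factorial_Ring.prime (2::int)" by simp
    show "lin_indep G 2 {t}" by (rule li)
  qed (rule that)
  define I where "I = I0 - {t}"
  have I: "I \<subseteq> carrier G" "\<forall>x\<in>I. x [^] int 2 = \<one>" using I0 by (auto simp: I_def H_def)
  let ?\<psi> = "\<lambda>x. gfinprod G (\<lambda>i. i [^] (x i :: int)) I"
  let ?SG = "sum_group I (\<lambda>_. integer_mod_group 2)"
  let ?Z = "integer_mod_group 4"
  let ?\<phi> = "\<lambda>(n, x). g [^] (n::int) \<otimes> ?\<psi> x"
  have pos: "(2::nat) > 0" by simp
  note eq = lin_map_eq[OF I pos]
  have \<psi>: "?\<psi> \<in> hom ?SG G" by (rule lin_map_hom[OF I pos])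
  have \<psi>c: "?\<psi> x \<in> carrier G" if "x \<in> carrier ?SG" for x using \<psi> that by (auto simp: hom_def)
  have car: "carrier ?SG = {x \<in> I \<rightarrow>\<^sub>E {0..<2}. finite {i \<in> I. x i \<noteq> 0}}"
    by (simp add: carrier_sum_group carrier_integer_mod_group)
  have carZ: "carrier ?Z = {0..<4}" by (simp add: carrier_integer_mod_group)
  have carD: "carrier (?Z \<times>\<times> ?SG) = {0..<4} \<times> carrier ?SG" by (simp add: DirProd_def carZ)
  have "?\<phi> \<in> hom (?Z \<times>\<times> ?SG) G"
  proof (rule homI)
    show "?\<phi> a \<in> carrier G" if "a \<in> carrier (?Z \<times>\<times> ?SG)" for a
      using that g \<psi>c by (auto simp: carD)
    fix a b assume ab: "a \<in> carrier (?Z \<times>\<times> ?SG)" "b \<in> carrier (?Z \<times>\<times> ?SG)"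
    obtain n x m y where nm: "a = (n, x)" "b = (m, y)" by fastforce
    have xy: "x \<in> carrier ?SG" "y \<in> carrier ?SG" using ab by (auto simp: nm carD)
    have "?\<phi> (a \<otimes>\<^bsub>?Z \<times>\<times> ?SG\<^esub> b) = g [^] ((n + m) mod 4) \<otimes> ?\<psi> (x \<otimes>\<^bsub>?SG\<^esub> y)"
      by (simp add: nm)
    also have "\<dots> = g [^] n \<otimes> g [^] m \<otimes> (?\<psi> x \<otimes> ?\<psi> y)"
      using hom_mult[OF \<psi> xy] int_pow_mod[OF g(1) g4] g by (simp only: int_pow_mult)
    also have "\<dots> = ?\<phi> a \<otimes> ?\<phi> b"
      using \<psi>c[OF xy(1)] \<psi>c[OF xy(2)] g by (simp add: nm m_ac)
    finally show "?\<phi> (a \<otimes>\<^bsub>?Z \<times>\<times> ?SG\<^esub> b) = ?\<phi> a \<otimes> ?\<phi> b" .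
  qed
  moreover have "inj_on ?\<phi> (carrier (?Z \<times>\<times> ?SG))"
  proof (rule inj_onI)
    fix a b assume ab: "a \<in> carrier (?Z \<times>\<times> ?SG)" "b \<in> carrier (?Z \<times>\<times> ?SG)" "?\<phi> a = ?\<phi> b"
    obtain n x m y where nm: "a = (n, x)" "b = (m, y)" by fastforce
    have xy: "x \<in> carrier ?SG" "y \<in> carrier ?SG" and n: "n \<in> {0..<4}" "m \<in> {0..<4}"
      using ab(1,2) unfolding nm carD by blast+
    define J where "J = {i \<in> I. x i \<noteq> 0} \<union> {i \<in> I. y i \<noteq> 0}"
    have J: "finite J" "J \<subseteq> I" "J \<subseteq> carrier G" using xy I by (auto simp: J_def car)
    define d where "d i = x i - y i" for i
    have L: "?\<psi> x = lincomb G x J" "?\<psi> y = lincomb G y J"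
      using eq[OF xy(1) J(2,1)] eq[OF xy(2) J(2,1)] by (auto simp: J_def)
    have "g [^] n \<otimes> lincomb G x J = g [^] m \<otimes> lincomb G y J" using ab(3) by (simp add: nm L)
    then have "g [^] n \<otimes> inv (g [^] m) = lincomb G y J \<otimes> inv (lincomb G x J)"
      using g J div_eq_div_iff[of "g [^] n" "g [^] m" "lincomb G y J" "lincomb G x J"]
      by (simp add: m_comm)
    then have nd: "g [^] (n - m) = lincomb G (\<lambda>i. - d i) J"
      using g J by (simp add: int_pow_diff lincomb_diff d_def)
    \<comment> \<open>Doubling kills the part coming from the \<open>2\<close>-torsion, which leaves
      \<open>(n - m) t = 0\<close>.\<close>
    have "lincomb G (\<lambda>i. - d i) J [^] (2::int) = lincomb G (\<lambda>i. 2 * - d i) J"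
      using J by (simp only: lincomb_mult)
    also have "\<dots> = finprod G (\<lambda>_. \<one>) J"
      unfolding lincomb_def
    proof (rule finprod_cong')
      show "i [^] (2 * - d i) = \<one>" if "i \<in> J" for i
        using I that J by (simp only: int_pow_pow[symmetric] subset_iff) simp
    qed auto
    finally have "(g [^] (n - m)) [^] (2::int) = \<one>" by (simp add: nd)
    then have "t [^] (n - m) = \<one>"
      unfolding t_def int_pow_pow[OF g(1)] by (simp only: mult.commute)
    then have "even (n - m)" using int_pow_order_2[OF t(1) t2] t(2) by (simp split: if_splits)
    then obtain k where k: "n - m = 2 * k" by (elim evenE)
    \<comment> \<open>With \<open>n - m = 2k\<close> the relation reads \<open>k t\<close> plus the
      combination \<open>d\<close>, so it is one between elements of the basis \<open>I0\<close>.
      Independence makes \<open>k\<close> even, so \<open>4\<close> divides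
      \<open>n - m\<close>.\<close>
    define c where "c i = (if i = t then k else d i)" for i
    have tJ: "t \<notin> J" using J by (auto simp: I_def)
    have "lincomb G c J = lincomb G d J" using tJ by (intro lincomb_cong[OF J(3)]) (auto simp: c_def)
    then have "lincomb G c (insert t J) = t [^] k \<otimes> lincomb G d J"
      using lincomb_insert[OF J(1) tJ J(3) t(1), of c] by (simp add: c_def)
    also have "t [^] k = lincomb G (\<lambda>i. - d i) J" using nd g by (simp add: t_def int_pow_pow k)
    also have "\<dots> \<otimes> lincomb G d J = \<one>" using J by (simp add: lincomb_uminus)
    finally have one: "lincomb G c (insert t J) = \<one>" .
    have dvd: "2 dvd c i" if "i \<in> insert t J" for i
      using lin_indepD[OF I0(3) _ _ one that] J I0 by (auto simp: I_def)
    have "2 dvd k" using dvd[of t] by (simp add: c_def)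
    then have "n = m" using k n unfolding atLeastLessThan_iff by presburger
    moreover have "x i = y i" if i: "i \<in> I" for i
    proof (cases "i \<in> J")
      case True
      then have "i \<noteq> t" using tJ by blast
      then have "2 dvd d i" using dvd[of i] True by (simp add: c_def)
      then have "x i mod 2 = y i mod 2" unfolding d_def by (simp only: mod_eq_dvd_iff)
      moreover have "x i \<in> {0..<2}" "y i \<in> {0..<2}" using xy i by (auto simp: car)
      ultimately show ?thesis by simp
    qed (use i in \<open>simp add: J_def\<close>)
    then have "x = y" using xy by (intro PiE_ext[of x I _ y]) (auto simp: car)
    ultimately show "a = b" by (simp add: nm)
  qed
  moreover have "carrier G \<subseteq> ?\<phi> ` carrier (?Z \<times>\<times> ?SG)"
  proof
    fix h assume h: "h \<in> carrier G"
    \<comment> \<open>Subtracting \<open>0\<close> or \<open>g\<close> moves \<open>h\<close> into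
      the \<open>2\<close>-torsion.\<close>
    obtain r :: int where r: "h \<otimes> inv (g [^] r) \<in> H"
    proof (cases "h [^] (2::int) = \<one>")
      case True
      then show ?thesis using that[of 0] h by (simp add: H_def)
    next
      case False
      then have "h [^] (2::int) = g [^] (2::int)" using sq[OF h] by blast
      then show ?thesis using that[of 1] h g by (simp add: H_def int_pow_distrib int_pow_inv)
    qed
    then obtain J c where J: "finite J" "J \<subseteq> I0" "h \<otimes> inv (g [^] r) = lincomb G c J" using span by blast
    have Jc: "J \<subseteq> carrier G" using J I0 by (auto simp: H_def)
    define K where "K = J - {t}"
    have K: "finite K" "K \<subseteq> I" "t \<notin> K" "K \<subseteq> carrier G" using J Jc by (auto simp: K_def I_def)
    obtain s :: int where s: "lincomb G c J = t [^] s \<otimes> lincomb G c K"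
    proof (cases "t \<in> J")
      case True
      then have "J = insert t K" by (auto simp: K_def)
      then show ?thesis using that[of "c t"] lincomb_insert[OF K(1,3,4) t(1), of c] by simp
    next
      case False
      then have "J = K" by (auto simp: K_def)
      then show ?thesis using that[of 0] K by simp
    qed
    obtain x where x: "x \<in> carrier ?SG" "?\<psi> x = lincomb G c K" using lin_map_surj[OF I pos K(1,2)] by blast
    have "h = h \<otimes> inv (g [^] r) \<otimes> g [^] r" using h g by (simp add: m_assoc)
    also have "\<dots> = t [^] s \<otimes> ?\<psi> x \<otimes> g [^] r" using J(3) s x(2) by simp
    \<comment> \<open>The \<open>t\<close>-part is \<open>2s g\<close> and is absorbed into the
      cyclic factor.\<close>
    also have "\<dots> = g [^] (2 * s + r) \<otimes> ?\<psi> x"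
      using \<psi>c[OF x(1)] g by (simp add: t_def int_pow_pow int_pow_mult m_ac)
    also have "g [^] (2 * s + r) = g [^] ((2 * s + r) mod 4)" by (rule int_pow_mod[OF g(1) g4, symmetric])
    finally have "h = ?\<phi> ((2 * s + r) mod 4, x)" by simp
    moreover have "((2 * s + r) mod 4, x) \<in> carrier (?Z \<times>\<times> ?SG)"
      unfolding carD using x(1) by simp
    ultimately show "h \<in> ?\<phi> ` carrier (?Z \<times>\<times> ?SG)" by blast
  qed
  moreover have "?\<phi> ` carrier (?Z \<times>\<times> ?SG) \<subseteq> carrier G"
    unfolding carD using g \<psi>c by auto
  ultimately have "?\<phi> \<in> iso (?Z \<times>\<times> ?SG) G" unfolding iso_def bij_betw_def by blast
  then have "?Z \<times>\<times> ?SG \<cong> G" unfolding is_iso_def by blast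
  then have "G \<cong> ?Z \<times>\<times> ?SG" 
    by (rule group.iso_sym[rotated]) (rule DirProd_group, simp_all)
  then show ?thesis unfolding iso_Z4_plus_direct_sum_Z2_def by blast
qed

subsection \<open>The exceptional groups\<close>

lemma sum_group_proj_hom:
  assumes "i \<in> I" "\<And>i. i \<in> I \<Longrightarrow> group (A i)"
  shows "(\<lambda>x. x i) \<in> hom (sum_group I A) (A i)"
  using assms by (intro homI) (auto simp: carrier_sum_group)

lemma sum_group_eq_one:
  assumes "x \<in> carrier (sum_group I (\<lambda>_. integer_mod_group n))" "\<And>i. i \<in> I \<Longrightarrow> x i = 0"
  shows "x = \<one>\<^bsub>sum_group I (\<lambda>_. integer_mod_group n)\<^esub>"
  using assms by (auto simp: carrier_sum_group PiE_def extensional_def fun_eq_iff)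

lemma hom_to_integer_mod_group_pow:
  assumes "h \<in> hom G (integer_mod_group n)" "group G" "x \<in> carrier G"
  shows "h (x [^]\<^bsub>G\<^esub> (k::int)) = (k * h x) mod int n"
  using hom_int_pow[OF assms(1,3,2), of k] by (simp add: int_pow_integer_mod_group)

lemma (in comm_group) iso_direct_sum_int_pow:
  assumes "iso_direct_sum G n" and x: "x \<in> carrier G"
  shows "x [^] int n = \<one>"
proof -
  obtain I :: "'a set" and \<phi> where \<phi>: "\<phi> \<in> iso G (sum_group I (\<lambda>_. integer_mod_group n))"
    using assms(1) unfolding iso_direct_sum_def is_iso_def by blast
  let ?S = "sum_group I (\<lambda>_. integer_mod_group n)"
  have S: "group ?S" by simp
  have h: "\<phi> \<in> hom G ?S" and inj: "inj_on \<phi> (carrier G)" using \<phi> by (auto simp: iso_def bij_betw_def)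
  have "\<phi> (x [^] int n) i = 0" if "i \<in> I" for i
  proof -
    have "(\<lambda>x. x i) \<circ> \<phi> \<in> hom G (integer_mod_group n)"
      by (rule Group.hom_compose[OF h sum_group_proj_hom[OF that]]) simp
    from hom_to_integer_mod_group_pow[OF this is_group x, of "int n"] show ?thesis by simp
  qed
  then have "\<phi> (x [^] int n) = \<phi> \<one>"
    unfolding hom_one[OF h is_group S] using h x by (intro sum_group_eq_one) (auto simp: hom_def)
  then show ?thesis using inj_onD[OF inj] x by simp
qed

text \<open>Doubling kills every coordinate of order \<open>2\<close>, and \<open>2\<close> is the
  only nonzero double modulo \<open>4\<close>.\<close>

lemma (in comm_group) iso_Z4_plus_direct_sum_Z2_squares:
  assumes "iso_Z4_plus_direct_sum_Z2 G" and xy: "x \<in> carrier G" "y \<in> carrier G"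
    and ne: "x [^] (2::int) \<noteq> \<one>" "y [^] (2::int) \<noteq> \<one>"
  shows "x [^] (2::int) = y [^] (2::int)"
proof -
  obtain I :: "'a set" and \<phi> where
    \<phi>: "\<phi> \<in> iso G (integer_mod_group 4 \<times>\<times> sum_group I (\<lambda>_. integer_mod_group 2))"
    using assms(1) unfolding iso_Z4_plus_direct_sum_Z2_def is_iso_def by blast
  let ?S = "sum_group I (\<lambda>_. integer_mod_group 2)" and ?Z = "integer_mod_group 4"
  have S: "group ?S" "group ?Z" by simp_all
  have D: "group (?Z \<times>\<times> ?S)" by (intro DirProd_group S)
  have h: "\<phi> \<in> hom G (?Z \<times>\<times> ?S)" and inj: "inj_on \<phi> (carrier G)"
    using \<phi> by (auto simp: iso_def bij_betw_def)
  have fst: "fst \<circ> \<phi> \<in> hom G ?Z" and snd: "snd \<circ> \<phi> \<in> hom G ?S"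
    using h by (auto simp: hom_def DirProd_def case_prod_beta Pi_iff)
  have two: "\<phi> (z [^] (2::int)) = (2, \<one>\<^bsub>?S\<^esub>)" if z: "z \<in> carrier G" "z [^] (2::int) \<noteq> \<one>" for z
  proof -
    have "snd (\<phi> (z [^] (2::int))) i = 0" if "i \<in> I" for i
    proof -
      have "(\<lambda>x. x i) \<circ> (snd \<circ> \<phi>) \<in> hom G (integer_mod_group 2)"
        by (rule Group.hom_compose[OF snd sum_group_proj_hom[OF that]]) simp
      from hom_to_integer_mod_group_pow[OF this is_group z(1), of 2] show ?thesis by simp
    qed
    then have s: "snd (\<phi> (z [^] (2::int))) = \<one>\<^bsub>?S\<^esub>"
      using snd z by (intro sum_group_eq_one) (auto simp: hom_def)
    have "fst (\<phi> (z [^] (2::int))) = (2 * fst (\<phi> z)) mod 4"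
      using hom_to_integer_mod_group_pow[OF fst is_group z(1), of 2] by simp
    moreover have "\<phi> (z [^] (2::int)) \<noteq> \<phi> \<one>" using inj_onD[OF inj] z by fastforce
    then have "\<phi> (z [^] (2::int)) \<noteq> (0, \<one>\<^bsub>?S\<^esub>)" using hom_one[OF h is_group D] by simp
    then have "fst (\<phi> (z [^] (2::int))) \<noteq> 0" using s by (metis prod.collapse)
    ultimately have "fst (\<phi> (z [^] (2::int))) = 2" by presburger
    then show ?thesis using s by (metis prod.collapse)
  qed
  show ?thesis using two[OF xy(1) ne(1)] two[OF xy(2) ne(2)] xy by (intro inj_onD[OF inj]) auto
qed

text \<open>A positive finite supremum is attained: otherwise \<open>n - 1\<close> would already
  bound all packings.\<close>

lemma packing_index_eq_finiteD:
  assumes ind: "packing_index G A =o |{..<n::nat}|"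
  shows "packing G A B \<Longrightarrow> finite B \<and> card B \<le> n"
    and "n > 0 \<Longrightarrow> \<exists>B. packing G A B \<and> finite B \<and> card B = n"
proof -
  have le: "finite B \<and> card B \<le> n" if "packing G A B" for B
  proof -
    have "|B| \<le>o |{..<n}|" using packing_index_upper[OF that] ind ordLeq_ordIso_trans by blast
    moreover then have "finite B" using card_of_ordLeq_finite by blast
    ultimately show ?thesis using finite_card_of_iff_card2[of B "{..<n}"] by simp
  qed
  then show "packing G A B \<Longrightarrow> finite B \<and> card B \<le> n" .
  show "\<exists>B. packing G A B \<and> finite B \<and> card B = n" if n: "n > 0"
  proof (rule ccontr)
    assume no: "\<not> ?thesis"
    have "packing_index G A \<le>o |{..<n - 1}|"
    proof (rule packing_index_least)
      fix B assume B: "packing G A B"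
      then have "finite B" "card B \<le> n - 1" using le[OF B] no n by fastforce+
      then show "|B| \<le>o |{..<n - 1}|" using finite_card_of_iff_card2[of B "{..<n - 1}"] by simp
    qed simp
    then have "|{..<n}| \<le>o |{..<n - 1}|" using ind ordIso_symmetric ordIso_ordLeq_trans by blast
    then show False using finite_card_of_iff_card2[of "{..<n}" "{..<n - 1}"] n by simp
  qed
qed

text \<open>As \<open>3g = 0\<close> gives \<open>2g = -g\<close>, all nonzero differences in
  \<open>{0, g, -g}\<close> are \<open>g\<close> or \<open>-g\<close>. These already occur between
  the two members of the given packing.\<close>

lemma (in comm_group) no_index_two:
  assumes A: "A \<subseteq> carrier G" and exp: "\<And>x. x \<in> carrier G \<Longrightarrow> x [^] (3::int) = \<one>"
  shows "\<not> packing_index G A =o |{..<2::nat}|"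
proof
  assume ind: "packing_index G A =o |{..<2::nat}|"
  obtain B where B: "packing G A B" "finite B" "card B = 2"
    using packing_index_eq_finiteD(2)[OF ind] by auto
  then obtain u v where uv: "B = {u, v}" "u \<noteq> v" by (auto simp: card_2_iff)
  define D where "D x \<longleftrightarrow> (\<exists>a\<in>A. \<exists>a'\<in>A. x = a \<otimes> inv a')" for x
  have pk: "packing G A C \<longleftrightarrow> C \<subseteq> carrier G \<and> (\<forall>b\<in>C. \<forall>b'\<in>C. b \<noteq> b' \<longrightarrow> \<not> D (b \<otimes> inv b'))" for C
    unfolding D_def by (rule packing_iff[OF A])
  have c: "u \<in> carrier G" "v \<in> carrier G" and d: "\<not> D (u \<otimes> inv v)" "\<not> D (v \<otimes> inv u)"
    using B(1) uv unfolding pk by auto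
  define g where "g = u \<otimes> inv v"
  have g: "g \<in> carrier G" "g \<noteq> \<one>" using c uv by (auto simp: g_def div_eq_one_iff)
  have dg: "\<not> D g" "\<not> D (inv g)" using d c by (simp_all add: g_def inv_mult_group)
  have "g [^] (3::int) = g \<otimes> g \<otimes> g"
    using int_pow_mult[OF g(1), of 2 1] g(1) by (simp add: int_pow_2)
  then have "g \<otimes> g \<otimes> g = \<one>" using exp[OF g(1)] by simp
  then have gg: "inv g = g \<otimes> g" using g(1) by (intro inv_equality) simp_all
  have ii: "inv g \<otimes> inv g = g"
    using inv_mult_group[OF g(1,1)] g(1) by (simp add: gg[symmetric])
  have ne: "inv g \<noteq> g" "inv g \<noteq> \<one>"
    using g gg l_cancel_one[OF g(1,1)] inv_eq_1_iff[OF g(1)] by auto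
  have "packing G A {\<one>, g, inv g}"
    unfolding pk using g dg ii by (auto simp: gg[symmetric])
  then have "card {\<one>, g, inv g} \<le> 2" using packing_index_eq_finiteD(1)[OF ind] by blast
  moreover have "card {\<one>, g, inv g} = 3" using g ne ne[symmetric] by simp
  ultimately show False by simp
qed

text \<open>After translation the packing is \<open>{0, a, b}\<close>. One of \<open>a\<close>,
  \<open>b\<close>, \<open>a - b\<close> has order \<open>2\<close>: if \<open>2a\<close> and
  \<open>2b\<close> are both nonzero they coincide by \<open>sq\<close>. That element is the
  \<open>s\<close> of \<open>four\<close>.\<close>

lemma (in comm_group) no_index_three:
  assumes A: "A \<subseteq> carrier G"
    and sq: "\<And>x y. x \<in> carrier G \<Longrightarrow> y \<in> carrier G \<Longrightarrow> x [^] (2::int) \<noteq> \<one> \<Longrightarrow>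
      y [^] (2::int) \<noteq> \<one> \<Longrightarrow> x [^] (2::int) = y [^] (2::int)"
  shows "\<not> packing_index G A =o |{..<3::nat}|"
proof
  assume ind: "packing_index G A =o |{..<3::nat}|"
  obtain B where B: "packing G A B" "finite B" "card B = 3"
    using packing_index_eq_finiteD(2)[OF ind] by auto
  then obtain u v w where uvw: "B = {u, v, w}" "u \<noteq> v" "v \<noteq> w" "u \<noteq> w"
    by (auto simp: card_3_iff)
  define D where "D x \<longleftrightarrow> (\<exists>a\<in>A. \<exists>a'\<in>A. x = a \<otimes> inv a')" for x
  have pk: "packing G A C \<longleftrightarrow> C \<subseteq> carrier G \<and> (\<forall>b\<in>C. \<forall>b'\<in>C. b \<noteq> b' \<longrightarrow> \<not> D (b \<otimes> inv b'))" for C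
    unfolding D_def by (rule packing_iff[OF A])
  have c: "u \<in> carrier G" "v \<in> carrier G" "w \<in> carrier G"
    and d: "\<not> D (u \<otimes> inv v)" "\<not> D (v \<otimes> inv u)" "\<not> D (u \<otimes> inv w)" "\<not> D (w \<otimes> inv u)"
      "\<not> D (v \<otimes> inv w)" "\<not> D (w \<otimes> inv v)"
    using B(1) uvw unfolding pk by auto
  \<comment> \<open>As \<open>-s = s\<close>, the nonzero differences in
    \<open>{0, s, z, s + z}\<close> are \<open>s\<close>, \<open>z\<close>, \<open>-z\<close>,
    \<open>s + z\<close> and \<open>s - z\<close>, so this set would be a packing with four
    elements.\<close>
  have four: False
    if s: "s \<in> carrier G" "s [^] (2::int) = \<one>" "s \<noteq> \<one>" and z: "z \<in> carrier G" "z \<noteq> \<one>" "z \<noteq> s"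
      and D: "\<not> D s" "\<not> D z" "\<not> D (inv z)" "\<not> D (s \<otimes> z)" "\<not> D (s \<otimes> inv z)" for s z
  proof -
    have ss: "s \<otimes> s = \<one>" using s by (simp add: int_pow_2)
    then have si: "inv s = s" using s by (simp add: inv_equality)
    have ssx: "s \<otimes> (s \<otimes> x) = x" if "x \<in> carrier G" for x
      using ss s that by (metis l_one m_assoc)
    have ne: "s \<otimes> z \<noteq> \<one>" "s \<otimes> z \<noteq> s" "s \<otimes> z \<noteq> z"
      using s z si inv_equality[of z s] by (auto simp: m_comm)
    have e: "z \<otimes> inv s = s \<otimes> z" "s \<otimes> z \<otimes> inv s = z" "s \<otimes> inv (s \<otimes> z) = inv z"
      "s \<otimes> z \<otimes> inv z = s" "z \<otimes> inv (s \<otimes> z) = s" "inv (s \<otimes> z) = s \<otimes> inv z"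
      using s(1) z(1) si by (simp_all add: inv_mult_group m_assoc m_comm m_lcomm ssx)
    have "packing G A {\<one>, s, z, s \<otimes> z}"
      unfolding pk using s z D si e by (auto simp: m_comm)
    then have "card {\<one>, s, z, s \<otimes> z} \<le> 3" using packing_index_eq_finiteD(1)[OF ind] by blast
    moreover have "card {\<one>, s, z, s \<otimes> z} = 4" using s z ne ne[symmetric] by simp
    ultimately show False by simp
  qed
  define a b where "a = u \<otimes> inv w" and "b = v \<otimes> inv w"
  have ab: "a \<in> carrier G" "b \<in> carrier G" using c by (simp_all add: a_def b_def)
  have one: "a \<noteq> \<one>" "b \<noteq> \<one>" "a \<noteq> b" using c uvw by (auto simp: a_def b_def div_eq_one_iff)
  have iab: "inv a = w \<otimes> inv u" "inv b = w \<otimes> inv v"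
    using c by (simp_all add: a_def b_def inv_mult_group)
  have div: "(x \<otimes> inv w) \<otimes> inv (y \<otimes> inv w) = x \<otimes> inv y" if "x \<in> carrier G" "y \<in> carrier G" for x y
    using that c div_eq_div_iff[of "x \<otimes> inv w" "y \<otimes> inv w" x y] by (simp add: m_ac)
  have dab: "a \<otimes> inv b = u \<otimes> inv v" "b \<otimes> inv a = v \<otimes> inv u"
    using c by (simp_all add: a_def b_def div)
  have D1: "\<not> D a" "\<not> D b" using d unfolding a_def b_def by simp_all
  have D2: "\<not> D (inv a)" "\<not> D (inv b)" using d unfolding iab by simp_all
  have D3: "\<not> D (a \<otimes> inv b)" "\<not> D (b \<otimes> inv a)" using d unfolding dab by simp_all
  note D = D1 D2 D3
  have self: "inv x = x" if "x \<in> carrier G" "x [^] (2::int) = \<one>" for x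
    using that by (simp add: int_pow_2 inv_equality)
  \<comment> \<open>For \<open>a = -a\<close>, both \<open>a + b\<close> and \<open>a - b\<close>
    are differences of the given packing up to the sign of \<open>a\<close>, so \<open>four\<close>
    applies.\<close>
  have a2: "a [^] (2::int) \<noteq> \<one>"
  proof
    assume "a [^] (2::int) = \<one>"
    then show False
      using four[of a b] ab one D self[OF ab(1)] by (simp add: m_comm)
  qed
  have b2: "b [^] (2::int) \<noteq> \<one>"
  proof
    assume "b [^] (2::int) = \<one>"
    then show False
      using four[of b a] ab one D self[OF ab(2)] by (simp add: m_comm)
  qed
  have "a [^] (2::int) = b [^] (2::int)" using sq ab a2 b2 by blast
  then have ab2: "(a \<otimes> inv b) [^] (2::int) = \<one>" using ab by (simp add: int_pow_distrib int_pow_inv)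
  \<comment> \<open>For \<open>s = a - b\<close> and \<open>z = b\<close>, the elements
    \<open>s + z\<close> and \<open>s - z\<close> are \<open>a\<close> and
    \<open>-a\<close>.\<close>
  have p: "a \<otimes> inv b \<otimes> b = a" using ab by (simp add: m_assoc)
  have "a \<otimes> inv b \<otimes> inv b = inv (a \<otimes> inv b) \<otimes> inv b" using self[OF _ ab2] ab by simp
  also have "\<dots> = inv a" using p ab by (simp add: m_comm flip: inv_mult)
  finally have p': "a \<otimes> inv b \<otimes> inv b = inv a" .
  have "b \<noteq> a \<otimes> inv b"
  proof
    assume "b = a \<otimes> inv b"
    then show False using ab2 b2 by simp
  qed
  then show False
    using four[OF _ ab2, of b] ab one D p p' by (simp add: div_eq_one_iff)
qed

section \<open>The remaining indices and the case distinction\<close>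

text \<open>This covers the top value \<open>\<kappa> = |G|\<close>, where
  \<open>realize_by_clique\<close> does not apply with \<open>F = B - B\<close> because it asks for
  \<open>F\<close> smaller than \<open>G\<close>.\<close>

lemma (in comm_group) packing_index_singleton: "packing_index G {\<one>} =o |carrier G|"
proof -
  have "packing G {\<one>} (carrier G)"
    by (subst packing_iff) (auto simp: div_eq_one_iff)
  then have "|carrier G| \<le>o packing_index G {\<one>}" by (rule packing_index_upper)
  moreover have "packing_index G {\<one>} \<le>o |carrier G|"
    by (rule packing_index_least) (auto simp: packing_def intro: card_of_mono1)
  ultimately show ?thesis by (simp add: ordIso_iff_ordLeq)
qed

lemma (in comm_group) packing_index_carrier: "packing_index G (carrier G) =o |{..<1::nat}|"
proof -
  have card1: "card B \<le> 1 \<and> finite B" if B: "packing G (carrier G) B" for B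
  proof -
    have "b = b'" if b: "b \<in> B" "b' \<in> B" for b b'
    proof (rule ccontr)
      assume "b \<noteq> b'"
      moreover have c: "b \<otimes> inv b' \<in> carrier G" using B b by (auto simp: packing_iff)
      moreover have "b \<otimes> inv b' = b \<otimes> inv b' \<otimes> inv \<one>" using c by simp
      ultimately show False using B b unfolding packing_iff[OF subset_refl] by blast
    qed
    then have "B = {} \<or> (\<exists>b. B = {b})" by blast
    then show ?thesis by auto
  qed
  have "packing G (carrier G) {\<one>}" by (simp add: packing_iff)
  then have "|{\<one>}| \<le>o packing_index G (carrier G)" by (rule packing_index_upper)
  moreover have "|{..<1::nat}| \<le>o |{\<one>}|"
    using finite_card_of_iff_card2[of "{..<1::nat}" "{\<one>}"] by simp
  moreover have "packing_index G (carrier G) \<le>o |{..<1::nat}|"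
  proof (rule packing_index_least)
    show "|B| \<le>o |{..<1::nat}|" if "packing G (carrier G) B" for B
      using card1[OF that] finite_card_of_iff_card2[of B "{..<1::nat}"] by simp
  qed simp
  ultimately show ?thesis using ordLeq_transitive by (auto simp: ordIso_iff_ordLeq)
qed

text \<open>The index \<open>1\<close> comes from \<open>A = G\<close>, finite values from
  \<open>4\<close> on and infinite values below \<open>|G|\<close> from the clique constructions,
  and \<open>|G|\<close> from a singleton.\<close>

lemma (in comm_group) exists_index_if_not_exceptional:
  assumes inf: "infinite (carrier G)" and \<kappa>: "Card_order \<kappa>" "|{..<1::nat}| \<le>o \<kappa>" "\<kappa> \<le>o |carrier G|"
    "\<not> \<kappa> =o |{..<2::nat}|" "\<not> \<kappa> =o |{..<3::nat}|"
  shows "\<exists>A\<subseteq>carrier G. packing_index G A =o \<kappa>"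
proof (cases "finite (Field \<kappa>)")
  case True
  define n where "n = card (Field \<kappa>)"
  have "|Field \<kappa>| =o |{..<n}|"
    using finite_card_of_iff_card[OF True, of "{..<n}"] by (simp add: n_def)
  then have \<kappa>n: "\<kappa> =o |{..<n}|"
    using card_of_Field_ordIso[OF \<kappa>(1)] ordIso_symmetric ordIso_transitive by blast
  then have "|{..<1::nat}| \<le>o |{..<n}|" using \<kappa>(2) ordLeq_ordIso_trans by blast
  then have "n \<ge> 1" using finite_card_of_iff_card2[of "{..<1::nat}" "{..<n}"] by simp
  moreover have "n \<noteq> 2" "n \<noteq> 3" using \<kappa>n \<kappa>(4,5) by auto
  ultimately consider "n = 1" | "n \<ge> 4" by linarith
  then have "\<exists>A\<subseteq>carrier G. packing_index G A =o |{..<n}|"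
  proof cases
    case 1
    then show ?thesis using packing_index_carrier by auto
  next
    case 2
    then show ?thesis by (intro exists_index_finite[OF inf]) auto
  qed
  then show ?thesis using \<kappa>n ordIso_symmetric ordIso_transitive by blast
next
  case inf\<kappa>: False
  show ?thesis
  proof (cases "\<kappa> <o |carrier G|")
    case True
    then show ?thesis by (rule exists_index_infinite[OF inf \<kappa>(1) inf\<kappa>])
  next
    case False
    then have "\<kappa> =o |carrier G|" using \<kappa>(3) ordLeq_iff_ordLess_or_ordIso by blast
    then have "packing_index G {\<one>} =o \<kappa>"
      using packing_index_singleton ordIso_symmetric ordIso_transitive by blast
    then show ?thesis by (intro exI[of _ "{\<one>}"]) simp
  qed
qed

theorem mainTheorem2:
  fixes G :: "('a, 'm) monoid_scheme" and \<kappa> :: "'k rel"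
  assumes "comm_group G" and "infinite (carrier G)" and "Card_order \<kappa>"
  shows "(\<exists>A \<subseteq> carrier G. packing_index G A =o \<kappa>) \<longleftrightarrow>
      ( |{..<1::nat}| \<le>o \<kappa> \<and> \<kappa> \<le>o |carrier G| \<and>
         \<not> (\<kappa> =o |{..<2::nat}| ) \<and> \<not> (\<kappa> =o |{..<3::nat}| ))
    \<or> (\<kappa> =o |{..<2::nat}| \<and> \<not> iso_direct_sum G 3)
    \<or> (\<kappa> =o |{..<3::nat}| \<and> \<not> iso_direct_sum G 2 \<and> \<not> iso_Z4_plus_direct_sum_Z2 G)"
    (is "?L \<longleftrightarrow> ?R1 \<or> ?R2 \<or> ?R3")
proof -
  interpret comm_group G by fact
  note inf = assms(2)
  have "?R1 \<or> ?R2 \<or> ?R3" if L: ?L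
  proof -
    obtain A where A: "A \<subseteq> carrier G" and ind: "packing_index G A =o \<kappa>" using L by blast
    have ind': "packing_index G A =o |{..<n}|" if "\<kappa> =o |{..<n}|" for n :: nat
      using ind that ordIso_transitive by blast
    have "packing G A {\<one>\<^bsub>G\<^esub>}" using A by (simp add: packing_iff)
    then have "|{\<one>\<^bsub>G\<^esub>}| \<le>o packing_index G A" by (rule packing_index_upper)
    moreover have "|{..<1::nat}| \<le>o |{\<one>\<^bsub>G\<^esub>}|"
      using finite_card_of_iff_card2[of "{..<1::nat}" "{\<one>\<^bsub>G\<^esub>}"] by simp
    ultimately have ge: "|{..<1::nat}| \<le>o \<kappa>"
      using ind ordLeq_transitive ordLeq_ordIso_trans by blast
    have "packing_index G A \<le>o |carrier G|"
      by (rule packing_index_least) (auto simp: packing_def intro: card_of_mono1)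
    then have le: "\<kappa> \<le>o |carrier G|" using ind ordIso_symmetric ordIso_ordLeq_trans by blast
    have two: "\<not> iso_direct_sum G 3" if "\<kappa> =o |{..<2::nat}|"
    proof
      assume "iso_direct_sum G 3"
      then show False using no_index_two[OF A] iso_direct_sum_int_pow[of 3] ind'[OF that] by simp
    qed
    have three: "\<not> iso_direct_sum G 2 \<and> \<not> iso_Z4_plus_direct_sum_Z2 G" if "\<kappa> =o |{..<3::nat}|"
    proof (intro conjI notI)
      assume "iso_direct_sum G 2"
      then show False using no_index_three[OF A] iso_direct_sum_int_pow[of 2] ind'[OF that] by simp
    next
      assume "iso_Z4_plus_direct_sum_Z2 G"
      then show False
        using no_index_three[OF A iso_Z4_plus_direct_sum_Z2_squares] ind'[OF that] by blast
    qed
    show ?thesis using ge le two three by blast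
  qed
  moreover have ?L if ?R1 using exists_index_if_not_exceptional[OF inf assms(3)] that by blast
  moreover have ?L if R2: ?R2
  proof -
    obtain g where "g \<in> carrier G" "g [^]\<^bsub>G\<^esub> int 3 \<noteq> \<one>\<^bsub>G\<^esub>"
      using iso_direct_sum_of_prime_exponent[of 3] R2 by auto
    then have "\<exists>A\<subseteq>carrier G. packing_index G A =o |{..<2::nat}|"
      using exists_index_two[OF inf, of g] by simp
    then show ?thesis using R2 ordIso_symmetric ordIso_transitive by blast
  qed
  moreover have ?L if R3: ?R3
  proof -
    \<comment> \<open>Failure of the first isomorphism type gives \<open>a\<close> with
      \<open>2a \<noteq> 0\<close>; failure of the second gives \<open>b\<close> whose double is
      neither \<open>0\<close> nor \<open>2a\<close>.\<close>
    obtain a where a: "a \<in> carrier G" "a [^]\<^bsub>G\<^esub> (2::int) \<noteq> \<one>\<^bsub>G\<^esub>"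
      using iso_direct_sum_of_prime_exponent[of 2] R3 by auto
    obtain b where b: "b \<in> carrier G" "b [^]\<^bsub>G\<^esub> (2::int) \<noteq> \<one>\<^bsub>G\<^esub>" "b [^]\<^bsub>G\<^esub> (2::int) \<noteq> a [^]\<^bsub>G\<^esub> (2::int)"
      using iso_Z4_plus_direct_sum_Z2_of_squares[OF a] R3 by blast
    have "\<exists>A\<subseteq>carrier G. packing_index G A =o |{..<3::nat}|"
      using exists_index_three[OF inf a(1) b(1) a(2) b(2)] b(3) by metis
    then show ?thesis using R3 ordIso_symmetric ordIso_transitive by blast
  qed
  ultimately show ?thesis by blast
qed

end
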